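(* If $B$ is any measurable subset of $\mathbb{R}$, then there is a sequence of projections $P_n=[e^{ik_n\psi_n}H^2(\mathbb{R})]$, $n\in\mathbb{N}$, where $k_n>0$ and each $\psi_n$ is a real-valued function on $\mathbb{R}$, such that $P_n\to M_{\chi_B}$ in the strong operator topology as $n\to\infty$.
   Context: $H^2(\mathbb{R})\subseteq L^2(\mathbb{R})$ is the Hardy space of the upper half plane (boundary values on the real line). For a closed subspace $K$ of $L^2(\mathbb{R})$, $[K]$ denotes the orthogonal projection of $L^2(\mathbb{R})$ onto $K$; for a real-valued measurable function $\psi$, $e^{i\psi}H^2(\mathbb{R})=\{e^{i\psi}h:h\in H^2(\mathbb{R})\}$. $M_{\chi_B}$ is the operator on $L^2(\mathbb{R})$ of multiplication by the indicator function $\chi_B$ of $B$. *)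

theory Defs
  imports "HOL-Complex_Analysis.Complex_Analysis"
begin

text \<open>
  Elements of \<open>L\<^sup>2(\<real>)\<close> are represented by square integrable functions rather than by their
  a.e.-equivalence classes. The sets \<open>L2\<close>, \<open>hardy_H2\<close> and \<open>modulated_H2 k \<psi>\<close> (for measurable
  \<open>\<psi>\<close>) below are all saturated under a.e. equality, and equality in \<open>L\<^sup>2(\<real>)\<close> is equality a.e.
\<close>

definition L2 :: "(real \<Rightarrow> complex) set" where
  "L2 = {f \<in> borel_measurable lebesgue. integrable lebesgue (\<lambda>x. (norm (f x))\<^sup>2)}"

definition L2_inner :: "(real \<Rightarrow> complex) \<Rightarrow> (real \<Rightarrow> complex) \<Rightarrow> complex" where
  "L2_inner f g = (LINT x|lebesgue. f x * cnj (g x))"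

definition L2_norm :: "(real \<Rightarrow> complex) \<Rightarrow> real" where
  "L2_norm f = sqrt (LINT x|lebesgue. (norm (f x))\<^sup>2)"

text \<open>
  The Hardy space of holomorphic functions on the upper half plane, and the space of their
  boundary values on \<open>\<real>\<close>. Boundary values are taken as limits in \<open>L\<^sup>2(\<real>)\<close> of the horizontal
  traces \<open>x \<mapsto> F (x + i y)\<close> as \<open>y\<close> decreases to \<open>0\<close>; by Fatou's theorem they coincide a.e. with
  the nontangential limits of \<open>F\<close>.
\<close>

definition hardy_UHP :: "(complex \<Rightarrow> complex) set" where
  "hardy_UHP = {F. F holomorphic_on {z. Im z > 0} \<and>
     (SUP y\<in>{0<..}. \<integral>\<^sup>+ x. ennreal ((norm (F (Complex x y)))\<^sup>2) \<partial>lebesgue) < \<infinity>}"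

definition hardy_H2 :: "(real \<Rightarrow> complex) set" where
  "hardy_H2 = {f \<in> L2. \<exists>F\<in>hardy_UHP.
     ((\<lambda>y. L2_norm (\<lambda>x. F (Complex x y) - f x)) \<longlongrightarrow> 0) (at_right 0)}"

definition modulated_H2 :: "real \<Rightarrow> (real \<Rightarrow> real) \<Rightarrow> (real \<Rightarrow> complex) set" where
  "modulated_H2 k \<psi> = (\<lambda>h x. exp (\<i> * of_real (k * \<psi> x)) * h x) ` hardy_H2"

text \<open>
  \<open>P\<close> represents the orthogonal projection of \<open>L\<^sup>2(\<real>)\<close> onto the subspace \<open>K\<close>. For a linear subspace
  \<open>K\<close>, this determines \<open>P f\<close> up to a.e. equality, and such a \<open>P\<close> exists only if \<open>K\<close> is closed.
\<close>

definition is_orth_proj ::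
    "(real \<Rightarrow> complex) set \<Rightarrow> ((real \<Rightarrow> complex) \<Rightarrow> real \<Rightarrow> complex) \<Rightarrow> bool" where
  "is_orth_proj K P \<longleftrightarrow>
     (\<forall>f\<in>L2. P f \<in> K \<and> (\<forall>h\<in>K. L2_inner (\<lambda>x. f x - P f x) h = 0))"

definition mult_indicator :: "real set \<Rightarrow> (real \<Rightarrow> complex) \<Rightarrow> real \<Rightarrow> complex" where
  "mult_indicator B f = (\<lambda>x. indicator B x * f x)"

definition SOT_tendsto ::
    "(nat \<Rightarrow> (real \<Rightarrow> complex) \<Rightarrow> real \<Rightarrow> complex) \<Rightarrow>
     ((real \<Rightarrow> complex) \<Rightarrow> real \<Rightarrow> complex) \<Rightarrow> bool" where
  "SOT_tendsto T S \<longleftrightarrow>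
     (\<forall>f\<in>L2. (\<lambda>n. L2_norm (\<lambda>x. T n f x - S f x)) \<longlonglongrightarrow> 0)"

end

theory Submission imports Defs begin

text \<open>
  Take \<open>\<psi> x = - x\<close> on \<open>B\<close>, \<open>\<psi> x = x\<close> off
      \<open>B\<close>, and \<open>k\<^sub>n = n + 1\<close>. Then \<open>P\<^sub>n\<close> is the Hardy
          projection
  conjugated by the unitary \<open>e\<^bsup>ik\<psi>\<^esup>\<close>, and
      \<open>e\<^bsup>-ik\<psi>\<^esup> f\<close> equals \<open>e\<^bsup>ikx\<^esup> f\<close> for
          \<open>f\<close> supported in \<open>B\<close> and
  \<open>e\<^bsup>-ikx\<^esup> f\<close> for \<open>f\<close> supported off \<open>B\<close>. So it
      suffices that, for every \<open>f\<close> in \<open>L\<^sup>2\<close>, \<open>e\<^bsup>ikx\<^esup>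
          f\<close>
  approaches \<open>H\<^sup>2\<close> as \<open>k \<rightarrow> \<infinity>\<close>; conjugation then
      shows that \<open>e\<^bsup>-ikx\<^esup> f\<close> approaches the orthogonal complement
  of \<open>H\<^sup>2\<close>. As the functions \<open>1 / (x - a)\<close> with \<open>a\<close> not real
      span a dense subspace, one may take
  \<open>f = 1 / (x - a)\<close>. If \<open>a\<close> lies in the lower half plane,
      \<open>e\<^bsup>ikx\<^esup> f\<close> is in \<open>H\<^sup>2\<close>; otherwise
  \<open>(e\<^bsup>ikx\<^esup> - e\<^bsup>ika\<^esup>) / (x - a)\<close> is in \<open>H\<^sup>2\<close>
      and differs from \<open>e\<^bsup>ikx\<^esup> f\<close> by a function of norm
  proportional to \<open>e\<^bsup>- k Im a\<^esup>\<close>.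
\<close>

section \<open>The space of square integrable functions\<close>

text \<open>An element of \<open>hardy_H2\<close> is known only as the limit of traces of some
  \<open>F\<close>, so closedness and the existence of a projection have to be earned. Everything
  passes through \<open>regular_UHP\<close>, whose members extend across the real line and decay
  like \<open>1 / norm z\<close>, so that contour integrals can be taken on the line itself. Two
  facts tie this class to \<open>hardy_H2\<close>. Limits of regular traces stay in
  \<open>hardy_H2\<close>: the Poisson formula turns convergence on the real line into convergence
  on all horizontal lines at once. And every element of \<open>hardy_H2\<close> is orthogonal to
  conjugates of regular traces: Cauchy's theorem applies above the line, where \<open>F\<close> is
  bounded. As sums \<open>G + cnj H\<close> with regular \<open>G\<close> and \<open>H\<close> are
  dense, this splits L^2 into H^2 and conjugates of H^2 and thereby produces the projection. Density
  rests on the Poisson kernel being a difference of two simple poles: its Riemann sums lie in the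
  span of the poles and approximate indicators of intervals.\<close>

lemma L2_measurable: "f \<in> L2 \<Longrightarrow> f \<in> borel_measurable lebesgue"
  and L2_integrable: "f \<in> L2 \<Longrightarrow> integrable lebesgue (\<lambda>x. (norm (f x))\<^sup>2)"
  by (auto simp: L2_def)

lemma L2_norm_nonneg [simp]: "0 \<le> L2_norm f"
  by (simp add: L2_norm_def)

lemma L2_norm_square: "(L2_norm f)\<^sup>2 = (LINT x|lebesgue. (norm (f x))\<^sup>2)"
  by (simp add: L2_norm_def)

lemma nn_integral_L2:
  assumes "f \<in> L2"
  shows "(\<integral>\<^sup>+ x. ennreal ((norm (f x))\<^sup>2) \<partial>lebesgue) = ennreal ((L2_norm
      f)\<^sup>2)"
  unfolding L2_norm_square using L2_integrable[OF assms] by (intro nn_integral_eq_integral) auto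

text \<open>The Bochner integral defaults to 0 off the integrable functions, so a small
  \<open>L2_norm\<close> alone says nothing about membership in \<open>L2\<close>. The nonnegative
  integral has no such default and yields membership together with the bound.\<close>

lemma
  assumes f: "f \<in> borel_measurable lebesgue" and c: "0 \<le> c"
    and le: "(\<integral>\<^sup>+ x. ennreal ((norm (f x))\<^sup>2) \<partial>lebesgue) \<le> ennreal
        (c\<^sup>2)"
  shows L2I_nn_integral: "f \<in> L2" and L2_norm_le_nn_integral: "L2_norm f \<le> c"
proof -
  have "integrable lebesgue (\<lambda>x. (norm (f x))\<^sup>2)"
    using f le by (intro integrableI_bounded) (auto simp: ennreal_less_top order.strict_trans1)
  then show L2: "f \<in> L2" using f by (simp add: L2_def)
  have "(L2_norm f)\<^sup>2 \<le> c\<^sup>2"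
    using le unfolding nn_integral_L2[OF L2] by simp
  then show "L2_norm f \<le> c" using c by (rule power2_le_imp_le)
qed

lemma L2_dominated:
  assumes g: "g \<in> L2" and f: "f \<in> borel_measurable lebesgue" and "\<And>x. norm (f x) \<le> norm (g x)"
  shows "f \<in> L2"
proof -
  have "(\<integral>\<^sup>+ x. ennreal ((norm (f x))\<^sup>2) \<partial>lebesgue) \<le> ennreal
      ((L2_norm g)\<^sup>2)"
    unfolding nn_integral_L2[OF g, symmetric] using assms(3)
    by (intro nn_integral_mono ennreal_leI power_mono) auto
  from L2I_nn_integral[OF f _ this] show ?thesis by simp
qed

lemma L2_scale:
  assumes "f \<in> L2" shows "(\<lambda>x. c * f x) \<in> L2"
  using assms by (auto simp: L2_def norm_mult power_mult_distrib)

lemma L2_norm_scale: "L2_norm (\<lambda>x. c * f x) = norm c * L2_norm f"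
  by (simp add: L2_norm_def norm_mult power_mult_distrib real_sqrt_mult)

lemma L2_add:
  assumes f: "f \<in> L2" and g: "g \<in> L2" shows "(\<lambda>x. f x + g x) \<in> L2"
proof -
  have [measurable]: "f \<in> borel_measurable lebesgue" "g \<in> borel_measurable lebesgue"
    using f g by (auto simp: L2_measurable)
  have "(norm (f x + g x))\<^sup>2 \<le> 2 * (norm (f x))\<^sup>2 + 2 * (norm (g x))\<^sup>2" for x
  proof -
    have "(norm (f x + g x))\<^sup>2 \<le> (norm (f x) + norm (g x))\<^sup>2"
      by (intro power_mono norm_triangle_ineq) auto
    also have "\<dots> \<le> 2 * (norm (f x))\<^sup>2 + 2 * (norm (g x))\<^sup>2"
      using sum_squares_bound[of "norm (f x)" "norm (g x)"] by (simp add: power2_sum)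
    finally show ?thesis .
  qed
  then have "integrable lebesgue (\<lambda>x. (norm (f x + g x))\<^sup>2)"
    by (intro Bochner_Integration.integrable_bound
        [OF Bochner_Integration.integrable_add[OF integrable_mult_right[OF L2_integrable[OF f]]
          integrable_mult_right[OF L2_integrable[OF g]], of 2 2]]) (auto intro: order_trans)
  then show ?thesis by (simp add: L2_def)
qed

lemma L2_uminus: "f \<in> L2 \<Longrightarrow> (\<lambda>x. - f x) \<in> L2"
  using L2_scale[of f "-1"] by simp

lemma L2_diff: "f \<in> L2 \<Longrightarrow> g \<in> L2 \<Longrightarrow> (\<lambda>x. f x - g x) \<in> L2"
  using L2_add[of f "\<lambda>x. - g x"] L2_uminus[of g] by simp

lemma L2_norm_minus_commute: "L2_norm (\<lambda>x. f x - g x) = L2_norm (\<lambda>x. g x - f x)"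
  by (simp add: L2_norm_def norm_minus_commute)

lemma L2_cnj: "f \<in> L2 \<Longrightarrow> (\<lambda>x. cnj (f x)) \<in> L2"
  by (auto simp: L2_def intro: borel_measurable_continuous_onI[THEN measurable_compose_rev] 
      simp: continuous_on_cnj)

lemma L2_norm_cnj: "L2_norm (\<lambda>x. cnj (f x)) = L2_norm f"
  by (simp add: L2_norm_def)

lemma integrable_L2_mult:
  assumes f: "f \<in> L2" and g: "g \<in> L2" shows "integrable lebesgue (\<lambda>x. f x * g x)"
proof -
  have [measurable]: "f \<in> borel_measurable lebesgue" "g \<in> borel_measurable lebesgue"
    using f g by (auto simp: L2_measurable)
  have "norm (f x * g x) \<le> (norm (f x))\<^sup>2 + (norm (g x))\<^sup>2" for x
    using sum_squares_bound[of "norm (f x)" "norm (g x)"]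
      mult_nonneg_nonneg[OF norm_ge_zero[of "f x"] norm_ge_zero[of "g x"]]
    unfolding norm_mult by linarith
  then show ?thesis
    by (intro Bochner_Integration.integrable_bound
        [OF Bochner_Integration.integrable_add[OF L2_integrable[OF f] L2_integrable[OF g]]])
      (auto intro: order_trans)
qed

lemma integral_norm_mult_le_L2_norm:
  assumes f: "f \<in> L2" and g: "g \<in> L2"
  shows "(LINT x|lebesgue. norm (f x * g x)) \<le> L2_norm f * L2_norm g"
proof -
  have [measurable]: "f \<in> borel_measurable lebesgue" "g \<in> borel_measurable lebesgue"
    using f g by (auto simp: L2_measurable)
  let ?I = "LINT x|lebesgue. norm (f x * g x)"
  have "ennreal ?I = (\<integral>\<^sup>+ x. ennreal (norm (f x)) * ennreal (norm (g x)) \<partial>lebesgue)"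
    using integrable_norm[OF integrable_L2_mult[OF f g]]
    by (subst nn_integral_eq_integral[symmetric]) (auto simp: norm_mult ennreal_mult')
  then have "ennreal (?I\<^sup>2) \<le> ennreal ((L2_norm f)\<^sup>2) * ennreal ((L2_norm g)\<^sup>2)"
    using Cauchy_Schwarz_nn_integral[of "\<lambda>x. ennreal (norm (f x))" lebesgue "\<lambda>x. ennreal
        (norm (g x))"]
    by (simp add: ennreal_power nn_integral_L2[OF f, symmetric] nn_integral_L2[OF g, symmetric]
         flip: ennreal_power)
  then have "?I\<^sup>2 \<le> (L2_norm f * L2_norm g)\<^sup>2"
    by (simp add: power_mult_distrib flip: ennreal_mult')
  then show ?thesis by (rule power2_le_imp_le) simp
qed

lemma norm_integral_mult_le_L2_norm:
  assumes "f \<in> L2" and "g \<in> L2"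
  shows "norm (LINT x|lebesgue. f x * g x) \<le> L2_norm f * L2_norm g"
  using integral_norm_bound[of lebesgue "\<lambda>x. f x * g x"] integral_norm_mult_le_L2_norm[OF assms]
  by (rule order_trans)

lemma L2_norm_triangle:
  assumes f: "f \<in> L2" and g: "g \<in> L2"
  shows "L2_norm (\<lambda>x. f x + g x) \<le> L2_norm f + L2_norm g"
proof (rule power2_le_imp_le)
  have "(L2_norm (\<lambda>x. f x + g x))\<^sup>2 \<le>
      (LINT x|lebesgue. (norm (f x))\<^sup>2 + (norm (g x))\<^sup>2 + 2 * norm (f x * g x))"
    unfolding L2_norm_square
  proof (intro integral_mono L2_integrable L2_add f g Bochner_Integration.integrable_add
      integrable_mult_right integrable_norm integrable_L2_mult)
    fix x
    have "(norm (f x + g x))\<^sup>2 \<le> (norm (f x) + norm (g x))\<^sup>2"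
      by (intro power_mono norm_triangle_ineq) auto
    then show "(norm (f x + g x))\<^sup>2 \<le> (norm (f x))\<^sup>2 + (norm (g x))\<^sup>2 + 2 * norm (f
        x * g x)"
      by (simp add: power2_sum norm_mult)
  qed
  also have "\<dots> = (L2_norm f)\<^sup>2 + (L2_norm g)\<^sup>2 + 2 * (LINT x|lebesgue. norm (f x * g x))"
    unfolding L2_norm_square
    using L2_integrable[OF f] L2_integrable[OF g] integrable_norm[OF integrable_L2_mult[OF f g]] by simp
  also have "\<dots> \<le> (L2_norm f + L2_norm g)\<^sup>2"
    using integral_norm_mult_le_L2_norm[OF f g] by (simp add: power2_sum)
  finally show "(L2_norm (\<lambda>x. f x + g x))\<^sup>2 \<le> (L2_norm f + L2_norm g)\<^sup>2" .
qed simp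

lemma L2_norm_triangle_diff:
  assumes "f \<in> L2" "g \<in> L2" "h \<in> L2"
  shows "L2_norm (\<lambda>x. f x - h x) \<le> L2_norm (\<lambda>x. f x - g x) + L2_norm (\<lambda>x. g x
      - h x)"
  using L2_norm_triangle[OF L2_diff[OF assms(1,2)] L2_diff[OF assms(2,3)]] by simp

lemma L2_norm_le_add_diff:
  assumes "f \<in> L2" "g \<in> L2"
  shows "L2_norm f \<le> L2_norm g + L2_norm (\<lambda>x. f x - g x)"
  using L2_norm_triangle[OF assms(2) L2_diff[OF assms]] by simp

lemma
  assumes w: "w \<in> L2" and s: "\<And>n. s n \<in> borel_measurable lebesgue"
    and f: "f \<in> borel_measurable lebesgue"
    and lim: "AE x in lebesgue. (\<lambda>n. s n x) \<longlonglongrightarrow> f x"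
    and bound: "\<And>n x. norm (s n x) \<le> norm (w x)"
  shows L2_dominated_limit: "f \<in> L2"
    and L2_dominated_convergence: "(\<lambda>n. L2_norm (\<lambda>x. s n x - f x)) \<longlonglongrightarrow> 0"
proof -
  note [measurable] = s f
  have f_le: "AE x in lebesgue. norm (f x) \<le> norm (w x)"
    using lim
  proof eventually_elim
    case (elim x)
    show ?case by (rule LIMSEQ_le_const2[OF tendsto_norm[OF elim]]) (use bound in auto)
  qed
  then have "AE x in lebesgue. norm ((norm (f x))\<^sup>2) \<le> norm ((norm (w x))\<^sup>2)"
    by eventually_elim (auto intro: power_mono)
  then have "integrable lebesgue (\<lambda>x. (norm (f x))\<^sup>2)"
    using L2_integrable[OF w] by (intro Bochner_Integration.integrable_bound[OF L2_integrable[OF w]]) auto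
  then show "f \<in> L2" using f by (simp add: L2_def)
  have "(\<lambda>n. LINT x|lebesgue. (norm (s n x - f x))\<^sup>2) \<longlonglongrightarrow> (LINT
      x|(lebesgue::real measure). (0::real))"
  proof (rule integral_dominated_convergence)
    \<comment> \<open>The bound by \<open>w\<close> passes to the limit \<open>f\<close>, so
      \<open>s n - f\<close> is at most \<open>2 * norm (w x)\<close>; squaring gives the 4.\<close>
    show "integrable lebesgue (\<lambda>x. 4 * (norm (w x))\<^sup>2)"
      using L2_integrable[OF w] by simp
    show "AE x in lebesgue. (\<lambda>n. (norm (s n x - f x))\<^sup>2) \<longlonglongrightarrow> 0"
      using lim
    proof eventually_elim
      case (elim x)
      have "(\<lambda>n. (norm (s n x - f x))\<^sup>2) \<longlonglongrightarrow> (norm (f x - f x))\<^sup>2"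
        by (intro tendsto_intros elim)
      then show ?case by simp
    qed
    show "AE x in lebesgue. norm ((norm (s n x - f x))\<^sup>2) \<le> 4 * (norm (w x))\<^sup>2" for n
      using f_le
    proof eventually_elim
      case (elim x)
      have "norm (s n x - f x) \<le> 2 * norm (w x)"
        using norm_triangle_ineq4[of "s n x" "f x"] elim bound[of n x] by simp
      then have "(norm (s n x - f x))\<^sup>2 \<le> (2 * norm (w x))\<^sup>2" by (rule power_mono) simp
      then show ?case by (simp add: power_mult_distrib)
    qed
  qed auto
  then have "(\<lambda>n. sqrt (LINT x|lebesgue. (norm (s n x - f x))\<^sup>2)) \<longlonglongrightarrow>
      sqrt 0"
    by (intro tendsto_real_sqrt) simp
  then show "(\<lambda>n. L2_norm (\<lambda>x. s n x - f x)) \<longlonglongrightarrow> 0"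
    by (simp add: L2_norm_def)
qed

text \<open>Transfers Cauchy estimates to a pointwise limit before norm convergence is known. It
  serves both the horizontal traces of a limit of Hardy functions and the completeness of
  \<open>L2\<close>.\<close>

lemma L2_norm_Fatou:
  assumes s: "\<And>n. s n \<in> L2" and f: "f \<in> borel_measurable lebesgue"
    and lim: "AE x in lebesgue. (\<lambda>n. s n x) \<longlonglongrightarrow> f x"
    and bound: "\<And>n. L2_norm (s n) \<le> c"
  shows "f \<in> L2 \<and> L2_norm f \<le> c"
proof -
  have c: "0 \<le> c" using bound[of 0] by (meson L2_norm_nonneg order_trans)
  have "(\<integral>\<^sup>+ x. ennreal ((norm (f x))\<^sup>2) \<partial>lebesgue)
      = (\<integral>\<^sup>+ x. liminf (\<lambda>n. ennreal ((norm (s n x))\<^sup>2)) \<partial>lebesgue)"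
    using lim
  proof (intro nn_integral_cong_AE, eventually_elim)
    case (elim x)
    have "(\<lambda>n. ennreal ((norm (s n x))\<^sup>2)) \<longlonglongrightarrow> ennreal ((norm (f
        x))\<^sup>2)"
      by (intro tendsto_intros elim)
    from lim_imp_Liminf[OF trivial_limit_sequentially this] show ?case by (rule sym)
  qed
  also have "\<dots> \<le> liminf (\<lambda>n. \<integral>\<^sup>+ x. ennreal ((norm (s n x))\<^sup>2)
      \<partial>lebesgue)"
    using s[THEN L2_measurable] by (intro nn_integral_liminf) measurable
  also have "\<dots> \<le> ennreal (c\<^sup>2)"
  proof -
    have "(\<integral>\<^sup>+ x. ennreal ((norm (s n x))\<^sup>2) \<partial>lebesgue) \<le> ennreal
        (c\<^sup>2)" for n
      unfolding nn_integral_L2[OF s] by (intro ennreal_leI power_mono bound) auto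
    then show ?thesis
      by (intro Liminf_le) auto
  qed
  finally show ?thesis
    using L2I_nn_integral[OF f c] L2_norm_le_nn_integral[OF f c] by simp
qed

section \<open>Analytic functions in the upper half plane\<close>

lemma
  shows integrable_inverse_1_plus_square: "integrable lebesgue (\<lambda>x::real. inverse (1 + x\<^sup>2))"
    and integral_inverse_1_plus_square: "(LINT x|lebesgue. inverse (1 + x\<^sup>2)) = pi"
proof -
  have 1: "((arctan \<circ> real_of_ereal) \<longlongrightarrow> - (pi / 2)) (at_right (-\<infinity>))"
    "((arctan \<circ> real_of_ereal) \<longlongrightarrow> pi / 2) (at_left \<infinity>)"
    by (auto simp: ereal_tendsto_simps intro: tendsto_arctan_at_bot tendsto_arctan_at_top)
  have 2: "isCont (\<lambda>x::real. inverse (1 + x\<^sup>2)) x" for x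
    by (intro continuous_intros) (simp add: sum_power2_eq_zero_iff add_nonneg_eq_0_iff)
  note FTC = interval_integral_FTC_nonneg[of "-\<infinity>" "\<infinity>" arctan "\<lambda>x. inverse (1
      + x\<^sup>2)", OF _ DERIV_arctan 2 _ 1]
  have i: "integrable lborel (\<lambda>x::real. inverse (1 + x\<^sup>2))"
    using FTC(1) by (simp add: set_integrable_def)
  moreover have "(LINT x|lborel. inverse (1 + x\<^sup>2)) = pi"
    using FTC(2) by (simp add: interval_lebesgue_integral_def set_lebesgue_integral_def)
  ultimately show "integrable lebesgue (\<lambda>x::real. inverse (1 + x\<^sup>2))"
    "(LINT x|lebesgue. inverse (1 + x\<^sup>2)) = pi"
    by (simp_all add: integrable_completion integral_completion)
qed

lemma continuous_imp_measurable_lebesgue: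
  fixes f :: "real \<Rightarrow> 'a::topological_space"
  assumes "continuous_on UNIV f" shows "f \<in> borel_measurable lebesgue"
  using borel_measurable_continuous_onI[OF assms] by (intro measurable_completion) simp

lemma continuous_on_Complex_horizontal:
  assumes "F holomorphic_on {z. - \<delta> < Im z}" and "- \<delta> < y"
  shows "continuous_on UNIV (\<lambda>x. F (Complex x y))"
proof -
  have "continuous_on UNIV (\<lambda>x. Complex x y)"
    by (simp add: Complex_eq) (intro continuous_intros)
  then show ?thesis
    by (rule continuous_on_compose2[OF holomorphic_on_imp_continuous_on[OF assms(1)]]) (use assms(2) in auto)
qed

lemma open_Im_gt: "open {z. c < Im z}" and convex_Im_gt: "convex {z. c < Im z}"
  by (auto simp: open_halfspace_Im_gt convex_halfspace_Im_gt)

text \<open>The real-line integral of \<open>Q\<close> is a limit of integrals over large upper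
    semicircles.\<close>

lemma
  assumes hol: "Q holomorphic_on {z. - \<delta> < Im z}" and \<delta>: "0 < \<delta>"
    and bound: "\<And>z. 0 \<le> Im z \<Longrightarrow> R0 \<le> norm z \<Longrightarrow> norm (Q z)
        \<le> C / (norm z)\<^sup>2"
  shows integrable_half_plane_decay: "integrable lebesgue (\<lambda>x. Q (of_real x))"
    and integral_half_plane_decay: "(LINT x|lebesgue. Q (of_real x)) = 0"
proof -
  have cont: "continuous_on UNIV (\<lambda>x. Q (of_real x))"
    using continuous_on_Complex_horizontal[OF hol, of 0] \<delta> by (simp add: complex_of_real_def)
  define R1 where "R1 = max 1 R0"
  have R1: "1 \<le> R1" "R0 \<le> R1" by (auto simp: R1_def)
  have C: "0 \<le> C"
    using order_trans[OF norm_ge_zero bound[of "of_real R1"]] R1 by (simp add: zero_le_divide_iff)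
  have "compact ((\<lambda>x. norm (Q (of_real x)) * (1 + x\<^sup>2)) ` {-R1..R1})"
    by (intro compact_continuous_image continuous_intros continuous_on_subset[OF cont]) auto
  then obtain M where M: "\<And>x. x \<in> {-R1..R1} \<Longrightarrow> norm (Q (of_real x)) * (1 +
      x\<^sup>2) \<le> M"
    unfolding compact_eq_bounded_closed bounded_iff by fastforce
  \<comment> \<open>Compactness supplies \<open>M\<close> on \<open>{-R1..R1}\<close>; beyond it
    \<open>1 + x^2\<close> is at most \<open>2 * x^2\<close>, whence \<open>2 * C\<close>.\<close>
  have le: "norm (Q (of_real x)) \<le> max M (2 * C) * inverse (1 + x\<^sup>2)" for x
  proof -
    have pos: "0 < 1 + x\<^sup>2" by (simp add: add_pos_nonneg)
    have "norm (Q (of_real x)) * (1 + x\<^sup>2) \<le> max M (2 * C)"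
    proof (cases "x \<in> {-R1..R1}")
      case False
      then have x: "R1 \<le> \<bar>x\<bar>" by auto
      then have x2: "1 \<le> x\<^sup>2" using R1 by (metis abs_1 abs_le_square_iff abs_of_nonneg
          order_trans power_one zero_le_one abs_abs)
      have "norm (Q (of_real x)) * (1 + x\<^sup>2) \<le> (C / x\<^sup>2) * (2 * x\<^sup>2)"
        using bound[of "of_real x"] x R1 x2 C by (intro mult_mono) auto
      moreover have "x \<noteq> 0" using x2 by auto
      ultimately show ?thesis by auto
    qed (use M in \<open>auto simp: le_max_iff_disj\<close>)
    then show ?thesis using pos by (simp add: field_simps)
  qed
  show int: "integrable lebesgue (\<lambda>x. Q (of_real x))"
    by (rule Bochner_Integration.integrable_bound
        [OF integrable_mult_right[OF integrable_inverse_1_plus_square, of "max M (2 * C)"]])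
      (use order_trans[OF le abs_ge_self] in \<open>auto intro!: continuous_imp_measurable_lebesgue
          cont\<close>)
  \<comment> \<open>The strip and half plane form a convex set, so \<open>Q\<close> has a primitive
    there. The segment and the semicircle then have the same integral \<open>W R - W (-R)\<close>,
    which the length of the arc bounds by \<open>C * pi / R\<close>.\<close>
  obtain W where W: "\<And>z. z \<in> {z. - \<delta> < Im z} \<Longrightarrow> (W has_field_derivative Q
      z) (at z within {z. - \<delta> < Im z})"
    using holomorphic_convex_primitive'[OF convex_Im_gt open_Im_gt hol] by blast
  then have W': "(W has_field_derivative Q z) (at z)" if "- \<delta> < Im z" for z
    using W[of z] that at_within_open[OF _ open_Im_gt, of z "- \<delta>"] by simp
  have real_part: "(LINT x|lebesgue. indicator {-R..R} x *\<^sub>R Q (of_real x)) = W (of_real R) - W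
      (of_real (-R))"
    if "0 < R" for R
  proof -
    have "((\<lambda>x. W (of_real x)) has_vector_derivative Q (of_real x)) (at x within {-R..R})" for x
      using has_vector_derivative_real_field[OF W'[of "of_real x"]] \<delta> by simp
    then have "(LINT x|lborel. indicator {-R..R} x *\<^sub>R Q (of_real x)) = W (of_real R) - W (of_real (-R))"
      using that by (intro integral_FTC_Icc continuous_on_subset[OF cont]) auto
    moreover have "(\<lambda>x. indicator {-R..R} x *\<^sub>R Q (of_real x)) \<in> borel_measurable lborel"
      using borel_measurable_continuous_onI[OF cont] by simp
    ultimately show ?thesis by (simp add: integral_completion)
  qed
  have arc: "norm (W (of_real R) - W (of_real (-R))) \<le> C * pi / R" if R: "R1 \<le> R" for R
  proof -
    let ?c = "part_circlepath 0 R 0 pi"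
    have R0: "0 < R" using R R1 by simp
    have im: "z \<in> path_image ?c \<Longrightarrow> norm z = R \<and> 0 \<le> Im z" for z
      using R0 by (auto simp: path_image_part_circlepath norm_mult Im_exp sin_ge_zero exp_eq_polar)
    have "(Q has_contour_integral W (pathfinish ?c) - W (pathstart ?c)) ?c"
      using im \<delta> by (intro contour_integral_primitive[OF W]) force+
    from has_contour_integral_bound_part_circlepath[OF this, of "C / R\<^sup>2"]
    have "norm (W (pathfinish ?c) - W (pathstart ?c)) \<le> C / R\<^sup>2 * R * (pi - 0)"
      using bound im R R1 R0 C by fastforce
    then show ?thesis
      using R0 by (simp add: norm_minus_commute power2_eq_square exp_pi_i)
  qed
  have "(\<lambda>n. LINT x|lebesgue. indicator {-real n..real n} x *\<^sub>R Q (of_real x))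
      \<longlonglongrightarrow> (LINT x|lebesgue. Q (of_real x))"
  proof (rule integral_dominated_convergence[where w="\<lambda>x. norm (Q (of_real x))"])
    show "AE x in lebesgue. (\<lambda>n. indicator {-real n..real n} x *\<^sub>R Q (of_real x))
        \<longlonglongrightarrow> Q (of_real x)"
    proof (rule AE_I2)
      fix x :: real
      obtain N where "\<bar>x\<bar> \<le> real N" using real_arch_simple by blast
      then have "\<forall>\<^sub>F n in sequentially. indicator {-real n..real n} x *\<^sub>R Q (of_real
          x) = Q (of_real x)"
        by (intro eventually_sequentiallyI[of N]) (auto simp: indicator_def)
      then show "(\<lambda>n. indicator {-real n..real n} x *\<^sub>R Q (of_real x))
          \<longlonglongrightarrow> Q (of_real x)"
        by (rule tendsto_eventually)
    qed
  qed (use int in \<open>auto split: split_indicator intro!: borel_measurable_scaleR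
      borel_measurable_indicator\<close>)
  moreover have "(\<lambda>n. LINT x|lebesgue. indicator {-real n..real n} x *\<^sub>R Q (of_real x))
      \<longlonglongrightarrow> 0"
  proof (rule Lim_null_comparison)
    obtain N where "R1 \<le> real N" using real_arch_simple by blast
    then show "\<forall>\<^sub>F n in sequentially. norm (LINT x|lebesgue. indicator {-real n..real n} x
        *\<^sub>R Q (of_real x)) \<le> C * pi / real n"
      using R1 arc
      by (intro eventually_sequentiallyI[of N]) (subst real_part, auto simp del: of_real_of_nat_eq)
    show "(\<lambda>n. C * pi / real n) \<longlonglongrightarrow> 0" by (rule lim_const_over_n)
  qed
  ultimately show "(LINT x|lebesgue. Q (of_real x)) = 0" by (rule LIMSEQ_unique)
qed

text \<open>A dense class of Hardy functions, analytic across the boundary; it avoids nontangential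
    limits.\<close>

definition regular_UHP :: "(complex \<Rightarrow> complex) set" where
  "regular_UHP = {G. \<exists>\<delta>>0. \<exists>C. G holomorphic_on {z. - \<delta> < Im z} \<and>
     (\<forall>z. 0 \<le> Im z \<longrightarrow> norm (G z) * norm (z + \<i>) \<le> C)}"

text \<open>The weight \<open>norm (z + \<i>)\<close> never vanishes on the closed half plane, so
  the defining bound also controls \<open>G\<close> near 0. On a half disc compactness provides it;
  for \<open>norm z\<close> at least 1 the weight is at most \<open>2 * norm z\<close>.\<close>

lemma regular_UHPI:
  assumes hol: "G holomorphic_on {z. - \<delta> < Im z}" and \<delta>: "0 < \<delta>"
    and bound: "\<And>z. 0 \<le> Im z \<Longrightarrow> R \<le> norm z \<Longrightarrow> norm (G z) *
        norm z \<le> C"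
  shows "G \<in> regular_UHP"
proof -
  define R1 where "R1 = max 1 R"
  have "compact (cball 0 R1 \<inter> {z. 0 \<le> Im z})"
    by (intro compact_Int_closed) (auto simp: closed_halfspace_Im_ge)
  moreover have "continuous_on (cball 0 R1 \<inter> {z. 0 \<le> Im z}) (\<lambda>z. norm (G z) * norm (z
      + \<i>))"
    by (intro continuous_intros continuous_on_subset[OF holomorphic_on_imp_continuous_on[OF hol]]) (use
        \<delta> in auto)
  ultimately have "compact ((\<lambda>z. norm (G z) * norm (z + \<i>)) ` (cball 0 R1 \<inter> {z. 0 \<le>
      Im z}))"
    by (rule compact_continuous_image[rotated])
  then obtain M where M: "\<And>z. norm z \<le> R1 \<Longrightarrow> 0 \<le> Im z \<Longrightarrow> norm
      (G z) * norm (z + \<i>) \<le> M"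
    unfolding compact_eq_bounded_closed bounded_iff by fastforce
  have "norm (G z) * norm (z + \<i>) \<le> max M (2 * C)" if "0 \<le> Im z" for z
  proof (cases "norm z \<le> R1")
    case False
    then have z: "1 \<le> norm z" "R \<le> norm z" by (auto simp: R1_def)
    have "norm (z + \<i>) \<le> 2 * norm z" using norm_triangle_ineq[of z \<i>] z by simp
    then have "norm (G z) * norm (z + \<i>) \<le> norm (G z) * (2 * norm z)"
      by (rule mult_left_mono) simp
    also have "\<dots> \<le> 2 * C" using bound[OF that z(2)] by simp
    finally show ?thesis by simp
  qed (use M that in \<open>simp add: le_max_iff_disj\<close>)
  then show ?thesis using hol \<delta> unfolding regular_UHP_def by blast
qed

text \<open>The first decay estimate feeds contour integrals. The second does not depend on the
  height \<open>y\<close> and so gives one square integrable majorant for all horizontal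
  traces.\<close>

lemma regular_UHPE:
  assumes "G \<in> regular_UHP"
  obtains \<delta> C where "0 < \<delta>" "G holomorphic_on {z. - \<delta> < Im z}" "0 \<le> C"
    "\<And>z. 0 \<le> Im z \<Longrightarrow> z \<noteq> 0 \<Longrightarrow> norm (G z) \<le> C / norm z"
    "\<And>x y. 0 \<le> y \<Longrightarrow> norm (G (Complex x y)) \<le> C * sqrt (inverse (1 + x\<^sup>2))"
proof -
  obtain \<delta> C where *: "0 < \<delta>" "G holomorphic_on {z. - \<delta> < Im z}"
    "\<And>z. 0 \<le> Im z \<Longrightarrow> norm (G z) * norm (z + \<i>) \<le> C"
    using assms unfolding regular_UHP_def by blast
  have C: "0 \<le> C" using order_trans[OF _ *(3)[of 0]] by simp
  have le: "norm (G z) \<le> C / b" if "0 \<le> Im z" "0 < b" "b \<le> norm (z + \<i>)" for z b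
  proof -
    have "norm (G z) * b \<le> norm (G z) * norm (z + \<i>)" using that by (intro mult_left_mono) auto
    then show ?thesis using *(3)[OF that(1)] that(2) by (simp add: pos_le_divide_eq)
  qed
  have "norm (G z) \<le> C / norm z" if z: "0 \<le> Im z" "z \<noteq> 0" for z
  proof (rule le)
    show "norm z \<le> norm (z + \<i>)" using z by (auto simp: norm_complex_def intro!: power_mono)
  qed (use z in auto)
  moreover have "norm (G (Complex x y)) \<le> C * sqrt (inverse (1 + x\<^sup>2))" if y: "0 \<le> y" for x y
  proof -
    have "1 \<le> (1 + y)\<^sup>2" using y by (simp add: one_le_power)
    then have "norm (G (Complex x y)) \<le> C / sqrt (1 + x\<^sup>2)"
      using y by (intro le) (auto simp: norm_complex_def add.commute add_pos_nonneg)
    then show ?thesis by (simp add: real_sqrt_inverse divide_inverse)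
  qed
  ultimately show thesis using * C that by blast
qed

text \<open>Complex valued so as to be an element of \<open>L2\<close> and a majorant in the
  dominated convergence lemmas; the root makes its square a multiple of the derivative of the
  arctangent.\<close>

definition decay_weight :: "real \<Rightarrow> real \<Rightarrow> complex" where
  "decay_weight c x = of_real (c * sqrt (inverse (1 + x\<^sup>2)))"

lemma norm_decay_weight: "0 \<le> c \<Longrightarrow> norm (decay_weight c x) = c * sqrt (inverse (1 +
    x\<^sup>2))"
  unfolding decay_weight_def norm_of_real by simp

lemma decay_weight_L2: "decay_weight c \<in> L2"
proof -
  have "continuous_on UNIV (decay_weight c)"
    unfolding decay_weight_def by (intro continuous_intros) (simp add: add_nonneg_eq_0_iff)
  moreover have "(norm (decay_weight c x))\<^sup>2 = c\<^sup>2 * inverse (1 + x\<^sup>2)" for x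
    unfolding decay_weight_def norm_of_real by (simp add: power_mult_distrib)
  ultimately show ?thesis
    unfolding L2_def using integrable_inverse_1_plus_square
    by (auto intro!: continuous_imp_measurable_lebesgue)
qed

lemma regular_UHP_measurable:
  assumes "G \<in> regular_UHP" "0 \<le> y"
  shows "(\<lambda>x. G (Complex x y)) \<in> borel_measurable lebesgue"
  using assms(1)
proof (rule regular_UHPE)
  fix \<delta> :: real
  assume "0 < \<delta>" "G holomorphic_on {z. - \<delta> < Im z}"
  then show ?thesis using assms(2)
    by (intro continuous_imp_measurable_lebesgue continuous_on_Complex_horizontal) auto
qed

lemma regular_UHP_L2:
  assumes G: "G \<in> regular_UHP" and y: "0 \<le> y"
  shows "(\<lambda>x. G (Complex x y)) \<in> L2"
proof -
  obtain C where "0 \<le> C" "\<And>x y. 0 \<le> y \<Longrightarrow> norm (G (Complex x y)) \<le> C *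
      sqrt (inverse (1 + x\<^sup>2))"
    using regular_UHPE[OF G] by metis
  then show ?thesis
    using y by (intro L2_dominated[OF decay_weight_L2[of C] regular_UHP_measurable[OF G y]])
      (simp add: norm_decay_weight)
qed

lemma regular_UHP_L2_real: "G \<in> regular_UHP \<Longrightarrow> (\<lambda>x. G (of_real x)) \<in> L2"
  using regular_UHP_L2[of G 0] by (simp add: complex_of_real_def)

text \<open>Continuity across the real line gives convergence at every point, and all traces share
  the majorant \<open>decay_weight C\<close>.\<close>

lemma regular_UHP_trace:
  assumes G: "G \<in> regular_UHP"
  shows "((\<lambda>y. L2_norm (\<lambda>x. G (Complex x y) - G (of_real x))) \<longlongrightarrow> 0)
      (at_right 0)"
proof (rule tendsto_at_right_sequentially[where b=1])
  obtain \<delta> C where \<delta>: "0 < \<delta>" and hol: "G holomorphic_on {z. - \<delta> < Im z}" and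
      C: "0 \<le> C"
    "\<And>x y. 0 \<le> y \<Longrightarrow> norm (G (Complex x y)) \<le> C * sqrt (inverse (1 + x\<^sup>2))"
    using regular_UHPE[OF G] by metis
  fix S :: "nat \<Rightarrow> real"
  assume S: "\<And>n. 0 < S n" "S \<longlonglongrightarrow> 0"
  show "(\<lambda>n. L2_norm (\<lambda>x. G (Complex x (S n)) - G (of_real x))) \<longlonglongrightarrow> 0"
  proof (rule L2_dominated_convergence[OF decay_weight_L2[of C]])
    show "AE x in lebesgue. (\<lambda>n. G (Complex x (S n))) \<longlonglongrightarrow> G (of_real x)"
    proof (rule AE_I2)
      fix x :: real
      have "isCont G (of_real x)"
        using holomorphic_on_imp_continuous_on[OF hol] \<delta>
        by (simp add: continuous_on_eq_continuous_at[OF open_Im_gt])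
      moreover have "(\<lambda>n. Complex x (S n)) \<longlonglongrightarrow> Complex x 0"
        by (intro tendsto_Complex tendsto_const S)
      ultimately show "(\<lambda>n. G (Complex x (S n))) \<longlonglongrightarrow> G (of_real x)"
        unfolding complex_of_real_def by (rule isCont_tendsto_compose)
    qed
  qed (use S(1)[THEN less_imp_le] C L2_measurable[OF regular_UHP_L2_real[OF G]] regular_UHP_measurable[OF G] in
      \<open>auto simp: norm_decay_weight\<close>)
qed auto

lemma regular_UHP_hardy_H2:
  assumes G: "G \<in> regular_UHP"
  shows "(\<lambda>x. G (of_real x)) \<in> hardy_H2"
proof -
  obtain \<delta> C where \<delta>: "0 < \<delta>" and hol: "G holomorphic_on {z. - \<delta> < Im z}" and
      C: "0 \<le> C"
    "\<And>x y. 0 \<le> y \<Longrightarrow> norm (G (Complex x y)) \<le> C * sqrt (inverse (1 + x\<^sup>2))"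
    using regular_UHPE[OF G] by metis
  let ?w = "decay_weight C"
  have "(\<integral>\<^sup>+ x. ennreal ((norm (G (Complex x y)))\<^sup>2) \<partial>lebesgue) \<le>
      ennreal ((L2_norm ?w)\<^sup>2)"
    if "0 < y" for y
    unfolding nn_integral_L2[OF decay_weight_L2, symmetric]
    using that C by (intro nn_integral_mono ennreal_leI power_mono) (auto simp: norm_decay_weight)
  then have "(SUP y\<in>{0<..}. \<integral>\<^sup>+ x. ennreal ((norm (G (Complex x y)))\<^sup>2)
      \<partial>lebesgue) \<le> ennreal ((L2_norm ?w)\<^sup>2)"
    by (intro SUP_least) auto
  then have "(SUP y\<in>{0<..}. \<integral>\<^sup>+ x. ennreal ((norm (G (Complex x y)))\<^sup>2)
      \<partial>lebesgue) < \<infinity>"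
    by (rule order.strict_trans1) simp
  moreover have "G holomorphic_on {z. Im z > 0}"
    by (rule holomorphic_on_subset[OF hol]) (use \<delta> in auto)
  ultimately have "G \<in> hardy_UHP" by (simp add: hardy_UHP_def)
  then show ?thesis
    using regular_UHP_trace[OF G] regular_UHP_L2_real[OF G] unfolding hardy_H2_def by blast
qed

lemma regular_UHP_add:
  assumes "F \<in> regular_UHP" "G \<in> regular_UHP" shows "(\<lambda>z. F z + G z) \<in> regular_UHP"
proof -
  obtain \<delta> C where 1: "0 < \<delta>" "F holomorphic_on {z. - \<delta> < Im z}"
    "\<And>z. 0 \<le> Im z \<Longrightarrow> norm (F z) * norm (z + \<i>) \<le> C"
    using assms(1) unfolding regular_UHP_def by blast
  obtain \<epsilon> D where 2: "0 < \<epsilon>" "G holomorphic_on {z. - \<epsilon> < Im z}"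
    "\<And>z. 0 \<le> Im z \<Longrightarrow> norm (G z) * norm (z + \<i>) \<le> D"
    using assms(2) unfolding regular_UHP_def by blast
  have "(\<lambda>z. F z + G z) holomorphic_on {z. - min \<delta> \<epsilon> < Im z}"
    by (intro holomorphic_intros holomorphic_on_subset[OF 1(2)] holomorphic_on_subset[OF 2(2)]) auto
  moreover have "norm (F z + G z) * norm (z + \<i>) \<le> C + D" if "0 \<le> Im z" for z
    using mult_right_mono[OF norm_triangle_ineq[of "F z" "G z"] norm_ge_zero[of "z + \<i>"]] 1(3)[OF
        that] 2(3)[OF that]
    by (simp add: distrib_right)
  ultimately show ?thesis using 1(1) 2(1) unfolding regular_UHP_def by (intro CollectI exI[of _ "min
      \<delta> \<epsilon>"]) auto
qed

lemma regular_UHP_scale: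
  assumes "G \<in> regular_UHP" shows "(\<lambda>z. c * G z) \<in> regular_UHP"
proof -
  obtain \<delta> C where 1: "0 < \<delta>" "G holomorphic_on {z. - \<delta> < Im z}"
    "\<And>z. 0 \<le> Im z \<Longrightarrow> norm (G z) * norm (z + \<i>) \<le> C"
    using assms(1) unfolding regular_UHP_def by blast
  have "(\<lambda>z. c * G z) holomorphic_on {z. - \<delta> < Im z}" by (intro holomorphic_intros 1)
  moreover have "norm (c * G z) * norm (z + \<i>) \<le> norm c * C" if "0 \<le> Im z" for z
    using mult_left_mono[OF 1(3)[OF that] norm_ge_zero[of c]] by (simp add: norm_mult mult.assoc)
  ultimately show ?thesis using 1(1) unfolding regular_UHP_def by blast
qed

lemma regular_UHP_diff:
  "F \<in> regular_UHP \<Longrightarrow> G \<in> regular_UHP \<Longrightarrow> (\<lambda>z. F z - G z)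
      \<in> regular_UHP"
  using regular_UHP_add[of F "\<lambda>z. (-1) * G z"] regular_UHP_scale[of G "-1"] by simp

section \<open>The Poisson formula\<close>

text \<open>Here \<open>y\<close> is the height, \<open>x\<close> the abscissa of the point of
  evaluation and \<open>t\<close> the boundary variable; dividing by \<open>pi\<close> makes the
  total mass 1.\<close>

definition poisson_kernel :: "real \<Rightarrow> real \<Rightarrow> real \<Rightarrow> real" where
  "poisson_kernel y x t = y / (pi * ((t - x)\<^sup>2 + y\<^sup>2))"

lemma poisson_kernel_nonneg: "0 < y \<Longrightarrow> 0 \<le> poisson_kernel y x t"
  by (simp add: poisson_kernel_def)

lemma poisson_kernel_commute: "poisson_kernel y x t = poisson_kernel y t x"
  by (simp add: poisson_kernel_def power2_commute)

lemma poisson_kernel_le: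
  assumes "0 < y" shows "poisson_kernel y x t \<le> 1 / (pi * y)"
proof -
  have "y / (pi * ((t - x)\<^sup>2 + y\<^sup>2)) \<le> y / (pi * y\<^sup>2)"
    using assms by (intro divide_left_mono mult_left_mono mult_pos_pos) (auto simp: add_nonneg_pos)
  then show ?thesis using assms by (simp add: poisson_kernel_def power2_eq_square)
qed

lemma poisson_kernel_measurable [measurable]:
  "(\<lambda>(x, t). poisson_kernel y x t) \<in> borel_measurable (borel \<Otimes>\<^sub>M borel)"
  unfolding poisson_kernel_def by measurable

lemma
  assumes y: "0 < y"
  shows integrable_poisson_kernel: "integrable lborel (poisson_kernel y x)"
    and integral_poisson_kernel: "(LINT t|lborel. poisson_kernel y x t) = 1"
proof -
  have int: "integrable lborel (\<lambda>x::real. inverse (1 + x\<^sup>2))"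
    and eq: "(LINT x|lborel. inverse (1 + x\<^sup>2)) = pi"
    using integrable_inverse_1_plus_square integral_inverse_1_plus_square
    by (simp_all add: integrable_completion integral_completion)
  have pk: "poisson_kernel y x t = 1 / (pi * y) * inverse (1 + (- x / y + 1 / y * t)\<^sup>2)" for t
  proof -
    have "1 + (- x / y + 1 / y * t)\<^sup>2 = ((t - x)\<^sup>2 + y\<^sup>2) / y\<^sup>2"
      using y by (simp add: field_simps power2_eq_square)
    then show ?thesis using y by (simp add: poisson_kernel_def field_simps power2_eq_square)
  qed
  have "integrable lborel (\<lambda>t. inverse (1 + (- x / y + 1 / y * t)\<^sup>2))"
    using lborel_integrable_real_affine[OF int, of "1 / y" "- x / y"] y by simp
  then show "integrable lborel (poisson_kernel y x)"
    unfolding pk by (rule integrable_mult_right)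
  have "pi = (LINT t|lborel. inverse (1 + (- x / y + 1 / y * t)\<^sup>2)) / y"
    using lborel_integral_real_affine[of "1 / y" "\<lambda>x. inverse (1 + x\<^sup>2)" "- x / y"] y eq by simp
  moreover have "(LINT t|lborel. poisson_kernel y x t) =
      1 / (pi * y) * (LINT t|lborel. inverse (1 + (- x / y + 1 / y * t)\<^sup>2))"
    unfolding pk by (rule integral_mult_right_zero)
  moreover have "p = 1" if "pi = I / y" "p = 1 / (pi * y) * I" for I p :: real
  proof -
    have "I = pi * y" using that(1) y by (simp add: eq_divide_eq)
    then show ?thesis using that(2) y by simp
  qed
  ultimately show "(LINT t|lborel. poisson_kernel y x t) = 1" by blast
qed

lemma nn_integral_poisson_kernel:
  assumes "0 < y" shows "(\<integral>\<^sup>+ t. ennreal (poisson_kernel y x t) \<partial>lborel) = 1"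
  using assms by (subst nn_integral_eq_integral)
    (auto simp: integrable_poisson_kernel integral_poisson_kernel poisson_kernel_nonneg)

lemma regular_UHP_borel:
  assumes "G \<in> regular_UHP" shows "(\<lambda>x. G (of_real x)) \<in> borel_measurable borel"
proof -
  obtain \<delta> where "0 < \<delta>" "G holomorphic_on {z. - \<delta> < Im z}"
    using assms by (rule regular_UHPE)
  then have "continuous_on UNIV (\<lambda>x. G (Complex x 0))"
    by (intro continuous_on_Complex_horizontal) auto
  then show ?thesis by (simp add: complex_of_real_def borel_measurable_continuous_onI)
qed

text \<open>With \<open>a = x + \<i> y\<close>, the quotient
  \<open>(G z - G a) / ((z - a) * (z - cnj a))\<close> has integral 0 over the line: subtracting
  \<open>G a\<close> removes the singularity at \<open>a\<close>, and \<open>cnj a\<close> lies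
  below the axis. For real \<open>t\<close> the denominator is \<open>(t - x)^2 + y^2\<close>, so
  the quotient is \<open>pi / y\<close> times the kernel times \<open>G t - G a\<close>; the mass of
  the kernel being 1 isolates \<open>G a\<close>.\<close>

lemma poisson_formula:
  assumes G: "G \<in> regular_UHP" and y: "0 < y"
  shows "integrable lborel (\<lambda>t. G (of_real t) * of_real (poisson_kernel y x t))"
    and "G (Complex x y) = (LINT t|lborel. G (of_real t) * of_real (poisson_kernel y x t))"
proof -
  obtain \<delta> C where \<delta>: "0 < \<delta>" and hol: "G holomorphic_on {z. - \<delta> < Im z}" and
      C: "0 \<le> C"
    "\<And>x y. 0 \<le> y \<Longrightarrow> norm (G (Complex x y)) \<le> C * sqrt (inverse (1 + x\<^sup>2))"
    using regular_UHPE[OF G] by metis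
  have G_le: "norm (G z) \<le> C" if "0 \<le> Im z" for z
  proof -
    have "sqrt (inverse (1 + (Re z)\<^sup>2)) \<le> 1" by (simp add: inverse_le_1_iff)
    then have "C * sqrt (inverse (1 + (Re z)\<^sup>2)) \<le> C" using C(1) mult_left_le by blast
    then show ?thesis using C(2)[OF that, of "Re z"] by simp
  qed
  define a where "a = Complex x y"
  have a: "Im a = y" "Re a = x" by (auto simp: a_def)
  let ?q = "\<lambda>z. (if z = a then deriv G a else (G z - G a) / (z - a))"
  let ?Q = "\<lambda>z. ?q z / (z - cnj a)"
  have "?q holomorphic_on {z. - \<delta> < Im z}"
    using a y \<delta> by (intro pole_lemma hol) (simp add: interior_open open_Im_gt)
  then have Q: "?Q holomorphic_on {z. - min \<delta> y < Im z}"
    using a by (intro holomorphic_intros) (auto elim!: holomorphic_on_subset)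
  \<comment> \<open>The numerator is at most \<open>2 * C\<close> and each of the two factors below
    is at least \<open>norm z / 2\<close>, which gives 8.\<close>
  have bound: "norm (?Q z) \<le> 8 * C / (norm z)\<^sup>2" if z: "0 \<le> Im z" "2 * norm a + 1 \<le>
      norm z" for z
  proof -
    have "norm z \<noteq> norm a" using z(2) norm_ge_zero[of a] by linarith
    then have "z \<noteq> a" by blast
    have 1: "norm z / 2 \<le> norm (z - a)" "norm z / 2 \<le> norm (z - cnj a)"
      using norm_triangle_ineq2[of z a] norm_triangle_ineq2[of z "cnj a"] z(2) by auto
    have "norm z > 0" using z(2) norm_ge_zero[of a] by linarith
    have "norm (G z - G a) \<le> 2 * C"
      using norm_triangle_ineq4[of "G z" "G a"] G_le[of z] G_le[of a] z a y by simp
    then have "norm (G z - G a) / (norm (z - a) * norm (z - cnj a)) \<le> 2 * C / (norm z / 2 * (norm z / 2))"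
      using 1 C(1) \<open>norm z > 0\<close> by (intro frac_le mult_mono) auto
    then show ?thesis
      using \<open>z \<noteq> a\<close> by (simp add: norm_divide norm_mult power2_eq_square)
  qed
  have Q_real: "?Q (of_real t) = of_real (pi / y) * (G (of_real t) * of_real (poisson_kernel y x t) - G a
      * of_real (poisson_kernel y x t))" for t
  proof -
    have ne: "of_real t \<noteq> a" using a y by auto
    have "(of_real t - a) * (of_real t - cnj a) = of_real ((t - x)\<^sup>2 + y\<^sup>2)"
      by (simp add: a_def complex_eq_iff power2_eq_square algebra_simps)
    then have "?Q (of_real t) = (G (of_real t) - G a) / of_real ((t - x)\<^sup>2 + y\<^sup>2)"
      using ne by (simp add: divide_divide_eq_left)
    moreover have "complex_of_real (pi / y) * of_real (poisson_kernel y x t) = 1 / of_real ((t -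
        x)\<^sup>2 + y\<^sup>2)"
      unfolding of_real_mult[symmetric] using y by (simp add: poisson_kernel_def)
    ultimately have "?Q (of_real t) = (G (of_real t) - G a) * (complex_of_real (pi / y) * of_real
        (poisson_kernel y x t))"
      by simp
    then show ?thesis by (simp only: algebra_simps)
  qed
  have iQ: "integrable lebesgue (\<lambda>t. ?Q (of_real t))" "(LINT t|lebesgue. ?Q (of_real t)) = 0"
    using integrable_half_plane_decay[OF Q _ bound] integral_half_plane_decay[OF Q _ bound] \<delta> y by auto
  have [measurable]: "(\<lambda>t. G (of_real t)) \<in> borel_measurable borel" by (rule
      regular_UHP_borel[OF G])
  have [measurable]: "poisson_kernel y x \<in> borel_measurable borel" unfolding poisson_kernel_def by
      measurable
  let ?D = "\<lambda>t. G (of_real t) * of_real (poisson_kernel y x t) - G a * of_real (poisson_kernel y x t)"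
  have m: "?D \<in> borel_measurable lborel" by measurable
  have c: "complex_of_real (pi / y) \<noteq> 0" using y by simp
  have "integrable lebesgue (\<lambda>t. inverse (complex_of_real (pi / y)) * (complex_of_real (pi / y) *
      ?D t))"
    using iQ(1) unfolding Q_real by (rule integrable_mult_right)
  then have "integrable lebesgue ?D"
    unfolding mult.assoc[symmetric] left_inverse[OF c] mult_1_left .
  then have D: "integrable lborel ?D" "(LINT t|lborel. ?D t) = 0"
    using iQ(2) c unfolding Q_real integral_mult_right_zero mult_eq_0_iff
      integrable_completion[OF m] integral_completion[OF m] by blast+
  have P: "integrable lborel (\<lambda>t. G a * of_real (poisson_kernel y x t))"
    using integrable_poisson_kernel[OF y] by (intro integrable_mult_right integrable_of_real)
  show i: "integrable lborel (\<lambda>t. G (of_real t) * of_real (poisson_kernel y x t))"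
    using Bochner_Integration.integrable_add[OF D(1) P] by simp
  have "(LINT t|lborel. G (of_real t) * of_real (poisson_kernel y x t)) = (LINT t|lborel. G a * of_real
      (poisson_kernel y x t))"
    using D(2) Bochner_Integration.integral_diff[OF i P] by simp
  also have "\<dots> = G a"
    using integral_poisson_kernel[OF y, of x] integrable_poisson_kernel[OF y, of x] by simp
  finally show "G (Complex x y) = (LINT t|lborel. G (of_real t) * of_real (poisson_kernel y x t))"
    by (simp add: a_def)
qed

text \<open>Jensen's inequality for the probability density \<open>poisson_kernel y x\<close>,
  obtained from Cauchy-Schwarz by writing the kernel as the square of its root.\<close>

lemma poisson_jensen:
  assumes G: "G \<in> regular_UHP" and y: "0 < y"
  shows "ennreal ((norm (G (Complex x y)))\<^sup>2) \<le>
    (\<integral>\<^sup>+ t. ennreal ((norm (G (of_real t)))\<^sup>2) * ennreal (poisson_kernel y x t)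
        \<partial>lborel)"
proof -
  have [measurable]: "(\<lambda>t. G (of_real t)) \<in> borel_measurable borel" by (rule
      regular_UHP_borel[OF G])
  have [measurable]: "poisson_kernel y x \<in> borel_measurable borel" unfolding poisson_kernel_def by
      measurable
  let ?p = "poisson_kernel y x"
  have p: "0 \<le> ?p t" for t by (rule poisson_kernel_nonneg[OF y])
  have "ennreal (norm (G (Complex x y))) \<le> (\<integral>\<^sup>+ t. norm (G (of_real t) * of_real (?p
      t)) \<partial>lborel)"
    unfolding poisson_formula(2)[OF G y] by (intro integral_norm_bound_ennreal poisson_formula(1) G y)
  also have "\<dots> = (\<integral>\<^sup>+ t. ennreal (norm (G (of_real t)) * sqrt (?p t)) * ennreal
      (sqrt (?p t)) \<partial>lborel)"
    using p by (intro nn_integral_cong) (simp add: norm_mult mult.assoc flip: ennreal_mult)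
  finally have "ennreal ((norm (G (Complex x y)))\<^sup>2) \<le>
      (\<integral>\<^sup>+ t. ennreal (norm (G (of_real t)) * sqrt (?p t)) * ennreal (sqrt (?p t))
          \<partial>lborel)\<^sup>2"
    by (simp add: power_mono flip: ennreal_power)
  also have "\<dots> \<le> (\<integral>\<^sup>+ t. (ennreal (norm (G (of_real t)) * sqrt (?p t)))\<^sup>2
      \<partial>lborel) *
      (\<integral>\<^sup>+ t. (ennreal (sqrt (?p t)))\<^sup>2 \<partial>lborel)"
    by (rule Cauchy_Schwarz_nn_integral) measurable
  also have "(\<integral>\<^sup>+ t. (ennreal (sqrt (?p t)))\<^sup>2 \<partial>lborel) = 1"
    using p by (simp add: ennreal_power nn_integral_poisson_kernel[OF y])
  also have "(\<integral>\<^sup>+ t. (ennreal (norm (G (of_real t)) * sqrt (?p t)))\<^sup>2 \<partial>lborel) =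
      (\<integral>\<^sup>+ t. ennreal ((norm (G (of_real t)))\<^sup>2) * ennreal (?p t) \<partial>lborel)"
    using p by (intro nn_integral_cong) (simp add: ennreal_power power_mult_distrib flip: ennreal_mult)
  finally show ?thesis by simp
qed

text \<open>Makes evaluation at a point of the upper half plane continuous in the norm of the
  boundary values, uniformly on each half plane \<open>c \<le> Im z\<close> with
  \<open>c > 0\<close>. The maximum \<open>1 / (pi * y)\<close> of the kernel gives the
  constant.\<close>

lemma regular_UHP_norm_le:
  assumes G: "G \<in> regular_UHP" and y: "0 < y"
  shows "(norm (G (Complex x y)))\<^sup>2 \<le> (L2_norm (\<lambda>x. G (of_real x)))\<^sup>2 / (pi * y)"
proof -
  have "ennreal ((norm (G (Complex x y)))\<^sup>2) \<le>
      (\<integral>\<^sup>+ t. ennreal ((norm (G (of_real t)))\<^sup>2) * ennreal (poisson_kernel y x t)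
          \<partial>lborel)"
    by (rule poisson_jensen[OF G y])
  also have "\<dots> \<le> (\<integral>\<^sup>+ t. ennreal ((norm (G (of_real t)))\<^sup>2) * ennreal (1
      / (pi * y)) \<partial>lborel)"
    using y by (intro nn_integral_mono mult_left_mono ennreal_leI poisson_kernel_le) auto
  also have "\<dots> = ennreal ((L2_norm (\<lambda>x. G (of_real x)))\<^sup>2) * ennreal (1 / (pi * y))"
    using regular_UHP_borel[OF G]
    by (subst nn_integral_multc) (auto simp: nn_integral_L2[OF regular_UHP_L2_real[OF G], symmetric]
        nn_integral_completion)
  also have "\<dots> = ennreal ((L2_norm (\<lambda>x. G (of_real x)))\<^sup>2 / (pi * y))"
    using y by (simp flip: ennreal_mult)
  finally show ?thesis using y by (simp add: ennreal_le_iff)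
qed

text \<open>After \<open>poisson_jensen\<close>, Tonelli moves the integration over \<open>x\<close>
  inside; by symmetry the kernel has mass 1 in that variable too.\<close>

lemma regular_UHP_contraction:
  assumes G: "G \<in> regular_UHP" and y: "0 < y"
  shows "L2_norm (\<lambda>x. G (Complex x y)) \<le> L2_norm (\<lambda>x. G (of_real x))"
proof (rule L2_norm_le_nn_integral)
  have [measurable]: "(\<lambda>t. G (of_real t)) \<in> borel_measurable borel" by (rule
      regular_UHP_borel[OF G])
  let ?g = "\<lambda>t. ennreal ((norm (G (of_real t)))\<^sup>2)"
  have "(\<integral>\<^sup>+ x. ennreal ((norm (G (Complex x y)))\<^sup>2) \<partial>lborel)
      \<le> (\<integral>\<^sup>+ x. (\<integral>\<^sup>+ t. ?g t * ennreal (poisson_kernel y x t)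
          \<partial>lborel) \<partial>lborel)"
    by (intro nn_integral_mono poisson_jensen G y)
  also have "\<dots> = (\<integral>\<^sup>+ t. (\<integral>\<^sup>+ x. ?g t * ennreal (poisson_kernel y x
      t) \<partial>lborel) \<partial>lborel)"
    by (rule lborel_pair.Fubini') (simp add: split_beta')
  also have "\<dots> = (\<integral>\<^sup>+ t. ?g t \<partial>lborel)"
  proof (rule nn_integral_cong)
    fix t
    have "(\<integral>\<^sup>+ x. ?g t * ennreal (poisson_kernel y x t) \<partial>lborel) =
        (\<integral>\<^sup>+ x. ?g t * ennreal (poisson_kernel y t x) \<partial>lborel)"
      by (simp add: poisson_kernel_commute)
    also have "\<dots> = ?g t"
      using nn_integral_poisson_kernel[OF y] by (subst nn_integral_cmult) (auto simp: poisson_kernel_def)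
    finally show "(\<integral>\<^sup>+ x. ?g t * ennreal (poisson_kernel y x t) \<partial>lborel) = ?g t" .
  qed
  also have "\<dots> = ennreal ((L2_norm (\<lambda>x. G (of_real x)))\<^sup>2)"
    by (simp add: nn_integral_L2[OF regular_UHP_L2_real[OF G], symmetric] nn_integral_completion)
  finally show "(\<integral>\<^sup>+ x. ennreal ((norm (G (Complex x y)))\<^sup>2) \<partial>lebesgue)
      \<le> ennreal ((L2_norm (\<lambda>x. G (of_real x)))\<^sup>2)"
    by (simp add: nn_integral_completion)
qed (use regular_UHP_measurable[OF G] y in auto)

section \<open>Limits and orthogonality in the Hardy space\<close>

text \<open>Point evaluations make the \<open>G n\<close> converge locally uniformly, so the limit
  \<open>F\<close> is holomorphic. The contraction keeps \<open>F\<close> close to one fixed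
  \<open>G n\<close> on every horizontal line simultaneously, and the boundary behaviour of that
  \<open>G n\<close> carries over to \<open>F\<close>.\<close>

lemma hardy_H2_regular_limit:
  fixes G :: "nat \<Rightarrow> complex \<Rightarrow> complex"
  assumes G: "\<And>n. G n \<in> regular_UHP" and f: "f \<in> L2"
    and lim: "(\<lambda>n. L2_norm (\<lambda>x. G n (of_real x) - f x)) \<longlonglongrightarrow> 0"
  shows "f \<in> hardy_H2"
proof -
  note L2 = regular_UHP_L2_real[OF G]
  have cau: "\<exists>N. \<forall>m\<ge>N. \<forall>n\<ge>N. L2_norm (\<lambda>x. G m (of_real x) - G n
      (of_real x)) < e" if e: "0 < e" for e
  proof -
    obtain N where N: "\<And>n. N \<le> n \<Longrightarrow> L2_norm (\<lambda>x. G n (of_real x) - f x) < e / 2"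
      using order_tendstoD(2)[OF lim half_gt_zero[OF e]] unfolding eventually_sequentially by blast
    have "L2_norm (\<lambda>x. G m (of_real x) - G n (of_real x)) < e" if "N \<le> m" "N \<le> n" for m n
      using L2_norm_triangle_diff[OF L2[of m] f L2[of n]] N[OF that(1)] N[OF that(2)]
        L2_norm_minus_commute[of f "\<lambda>x. G n (of_real x)"] by simp
    then show ?thesis by blast
  qed
  have pt: "norm (G m z - G n z) * sqrt (pi * Im z) \<le> L2_norm (\<lambda>x. G m (of_real x) - G n
      (of_real x))"
    if "0 < Im z" for m n z
  proof (rule power2_le_imp_le)
    have "(norm (G m z - G n z))\<^sup>2 \<le> (L2_norm (\<lambda>x. G m (of_real x) - G n (of_real
        x)))\<^sup>2 / (pi * Im z)"
      using regular_UHP_norm_le[OF regular_UHP_diff[OF G[of m] G[of n]] that, of "Re z"] by simp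
    then show "(norm (G m z - G n z) * sqrt (pi * Im z))\<^sup>2 \<le> (L2_norm (\<lambda>x. G m (of_real
        x) - G n (of_real x)))\<^sup>2"
      using that by (simp add: pos_le_divide_eq power_mult_distrib)
  qed simp
  \<comment> \<open>Convergence is shown for \<open>Im z > 0\<close> only; elsewhere
    \<open>lim\<close> may be a junk value.\<close>
  define F where "F z = lim (\<lambda>n. G n z)" for z
  have unif: "uniform_limit {z. c \<le> Im z} G F sequentially" if c: "0 < c" for c
  proof -
    have "uniformly_Cauchy_on {z. c \<le> Im z} G"
      unfolding uniformly_Cauchy_on_def
    proof (intro allI impI)
      fix e :: real assume e: "0 < e"
      obtain N where N: "\<And>m n. N \<le> m \<Longrightarrow> N \<le> n \<Longrightarrow> L2_norm
          (\<lambda>x. G m (of_real x) - G n (of_real x)) < e * sqrt (pi * c)"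
        using cau[of "e * sqrt (pi * c)"] e c by auto
      have "dist (G m z) (G n z) < e" if "N \<le> m" "N \<le> n" "c \<le> Im z" for m n z
      proof -
        have "norm (G m z - G n z) * sqrt (pi * c) \<le> norm (G m z - G n z) * sqrt (pi * Im z)"
          using that by (intro mult_left_mono) auto
        also have "\<dots> \<le> L2_norm (\<lambda>x. G m (of_real x) - G n (of_real x))" using that c by
            (intro pt) simp
        also have "\<dots> < e * sqrt (pi * c)" by (rule N[OF that(1,2)])
        finally show ?thesis using c by (simp add: dist_norm)
      qed
      then show "\<exists>M. \<forall>x\<in>{z. c \<le> Im z}. \<forall>m\<ge>M. \<forall>n\<ge>M. dist
          (G m x) (G n x) < e" by blast
    qed
    then show ?thesis
      unfolding F_def uniformly_convergent_uniform_limit_iff[symmetric] by (rule Cauchy_uniformly_convergent)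
  qed
  have F_lim: "(\<lambda>n. G n z) \<longlonglongrightarrow> F z" if "0 < Im z" for z
    using tendsto_uniform_limitI[OF unif[OF that], of z] by simp
  have hol: "F holomorphic_on {z. 0 < Im z}"
  proof (rule holomorphic_uniform_sequence[of _ G])
    show "G n holomorphic_on {z. 0 < Im z}" for n
      by (rule regular_UHPE[OF G[of n]]) (auto elim!: holomorphic_on_subset)
    fix z :: complex assume z: "z \<in> {z. 0 < Im z}"
    have "cball z (Im z / 2) \<subseteq> {w. Im z / 2 \<le> Im w}"
    proof
      fix w assume "w \<in> cball z (Im z / 2)"
      then have "Im (z - w) \<le> Im z / 2"
        using order_trans[OF abs_ge_self abs_Im_le_cmod[of "z - w"]] by (simp add: dist_norm)
      then show "w \<in> {w. Im z / 2 \<le> Im w}" by simp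
    qed
    moreover have "{w. Im z / 2 \<le> Im w} \<subseteq> {w. 0 < Im w}" using z by auto
    ultimately show "\<exists>d>0. cball z d \<subseteq> {z. 0 < Im z} \<and> uniform_limit (cball z d) G
        F sequentially"
      using z unif[of "Im z / 2"] by (intro exI[of _ "Im z / 2"]) (auto intro: uniform_limit_on_subset)
  qed (rule open_Im_gt)
  have F_meas: "(\<lambda>x. F (Complex x y)) \<in> borel_measurable lebesgue" if "0 < y" for y
    using continuous_on_Complex_horizontal[of F 0 y] hol that by (simp add: continuous_imp_measurable_lebesgue)
  \<comment> \<open>The index \<open>n\<close> is chosen before the height \<open>y\<close>: this
    uniformity lets \<open>y\<close> tend to 0 afterwards.\<close>
  have approx: "\<exists>n. L2_norm (\<lambda>x. G n (of_real x) - f x) < e \<and> (\<forall>y>0.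
      (\<lambda>x. F (Complex x y)) \<in> L2 \<and>
      L2_norm (\<lambda>x. F (Complex x y) - G n (Complex x y)) \<le> e)" if e: "0 < e" for e
  proof -
    obtain N where N: "\<And>m n. N \<le> m \<Longrightarrow> N \<le> n \<Longrightarrow> L2_norm
        (\<lambda>x. G m (of_real x) - G n (of_real x)) < e"
      using cau[OF e] by blast
    obtain N' where N': "\<And>n. N' \<le> n \<Longrightarrow> L2_norm (\<lambda>x. G n (of_real x) - f x) < e"
      using order_tendstoD(2)[OF lim e] unfolding eventually_sequentially by blast
    define n where "n = max N N'"
    have "(\<lambda>x. F (Complex x y)) \<in> L2 \<and> L2_norm (\<lambda>x. F (Complex x y) - G n
        (Complex x y)) \<le> e"
      if y: "0 < y" for y
    proof -
      \<comment> \<open>The shift by \<open>n\<close> places every term beyond \<open>N\<close>, so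
        the Fatou bound holds from the first one on.\<close>
      let ?s = "\<lambda>m x. G (m + n) (Complex x y) - G n (Complex x y)"
      note L2y = regular_UHP_L2[OF G less_imp_le[OF y]]
      have "(\<lambda>x. F (Complex x y) - G n (Complex x y)) \<in> L2 \<and> L2_norm (\<lambda>x. F
          (Complex x y) - G n (Complex x y)) \<le> e"
      proof (rule L2_norm_Fatou[of ?s])
        show "?s m \<in> L2" for m by (intro L2_diff L2y)
        show "(\<lambda>x. F (Complex x y) - G n (Complex x y)) \<in> borel_measurable lebesgue"
          using F_meas[OF y] L2_measurable[OF L2y[of n]] by (rule borel_measurable_diff)
        show "AE x in lebesgue. (\<lambda>m. ?s m x) \<longlonglongrightarrow> F (Complex x y) - G n
            (Complex x y)"
          using F_lim y by (intro AE_I2 tendsto_diff tendsto_const LIMSEQ_ignore_initial_segment) simp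
        show "L2_norm (?s m) \<le> e" for m
        proof -
          have "N \<le> n" "N \<le> m + n" by (simp_all add: n_def le_max_iff_disj trans_le_add2)
          then show ?thesis
            using regular_UHP_contraction[OF regular_UHP_diff[OF G[of "m + n"] G[of n]] y] N[of "m + n"
                n] by simp
        qed
      qed
      moreover from this have "(\<lambda>x. (F (Complex x y) - G n (Complex x y)) + G n (Complex x y)) \<in> L2"
        by (intro L2_add L2y) simp
      ultimately show ?thesis by simp
    qed
    then show ?thesis using N'[of n] by (auto simp: n_def)
  qed
  have "F \<in> hardy_UHP"
  proof -
    obtain n where n: "\<And>y. 0 < y \<Longrightarrow> (\<lambda>x. F (Complex x y)) \<in> L2"
      "\<And>y. 0 < y \<Longrightarrow> L2_norm (\<lambda>x. F (Complex x y) - G n (Complex x y)) \<le> 1"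
      using approx[of 1] by auto
    let ?c = "L2_norm (\<lambda>x. G n (of_real x)) + 1"
    have "(\<integral>\<^sup>+ x. ennreal ((norm (F (Complex x y)))\<^sup>2) \<partial>lebesgue) \<le>
        ennreal (?c\<^sup>2)" if y: "0 < y" for y
      unfolding nn_integral_L2[OF n(1)[OF y]]
      using L2_norm_le_add_diff[OF n(1)[OF y] regular_UHP_L2[OF G[of n] less_imp_le[OF y]]]
        n(2)[OF y] regular_UHP_contraction[OF G y, of n]
      by (intro ennreal_leI power_mono) auto
    then have "(SUP y\<in>{0<..}. \<integral>\<^sup>+ x. ennreal ((norm (F (Complex x y)))\<^sup>2)
        \<partial>lebesgue) \<le> ennreal (?c\<^sup>2)"
      by (intro SUP_least) auto
    then show ?thesis
      using hol order.strict_trans1[of _ "ennreal (?c\<^sup>2)" \<infinity>] by (simp add: hardy_UHP_def)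
  qed
  moreover have "((\<lambda>y. L2_norm (\<lambda>x. F (Complex x y) - f x)) \<longlongrightarrow> 0)
      (at_right 0)"
  proof (rule tendstoI)
    fix e :: real assume e: "0 < e"
    obtain n where n: "L2_norm (\<lambda>x. G n (of_real x) - f x) < e / 3" "\<And>y. 0 < y
        \<Longrightarrow> (\<lambda>x. F (Complex x y)) \<in> L2"
      "\<And>y. 0 < y \<Longrightarrow> L2_norm (\<lambda>x. F (Complex x y) - G n (Complex x y)) \<le> e / 3"
      using approx[of "e / 3"] e by auto
    have "\<forall>\<^sub>F y in at_right 0. L2_norm (\<lambda>x. G n (Complex x y) - G n (of_real x)) < e / 3"
      using order_tendstoD(2)[OF regular_UHP_trace[OF G[of n]], of "e / 3"] e by simp
    moreover have "\<forall>\<^sub>F y :: real in at_right 0. 0 < y" by (rule eventually_at_right_less)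
    ultimately show "\<forall>\<^sub>F y in at_right 0. dist (L2_norm (\<lambda>x. F (Complex x y) - f
        x)) 0 < e"
    proof eventually_elim
      case (elim y)
      note L2y = regular_UHP_L2[OF G[of n] less_imp_le[OF elim(2)]]
      show ?case
        using L2_norm_triangle_diff[OF n(2)[OF elim(2)] L2y f] L2_norm_triangle_diff[OF L2y L2[of n] f]
          n(1) n(3)[OF elim(2)] elim(1) by simp
    qed
  qed
  ultimately show ?thesis using f by (auto simp: hardy_H2_def)
qed

lemma
  assumes "E \<in> sets lebesgue" "emeasure lebesgue E < \<infinity>"
  shows indicator_L2: "(\<lambda>x. indicator E x) \<in> L2"
    and L2_norm_indicator: "L2_norm (\<lambda>x. indicator E x) = sqrt (measure lebesgue E)"
proof -
  have "(norm (indicator E x :: complex))\<^sup>2 = indicator E x" for x :: real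
    by (auto simp: indicator_def)
  then show "(\<lambda>x. indicator E x) \<in> L2" "L2_norm (\<lambda>x. indicator E x) = sqrt (measure
      lebesgue E)"
    using assms by (auto simp: L2_def L2_norm_def)
qed

lemma hardy_UHP_L2_bound:
  assumes "F \<in> hardy_UHP"
  obtains M where "0 \<le> M" "\<And>y. 0 < y \<Longrightarrow> (\<lambda>x. F (Complex x y)) \<in> L2"
    "\<And>y. 0 < y \<Longrightarrow> L2_norm (\<lambda>x. F (Complex x y)) \<le> M"
proof -
  let ?S = "SUP y\<in>{0<..}. \<integral>\<^sup>+ x. ennreal ((norm (F (Complex x y)))\<^sup>2)
      \<partial>lebesgue"
  have hol: "F holomorphic_on {z. 0 < Im z}" and S: "?S < \<infinity>"
    using assms unfolding hardy_UHP_def by blast+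
  obtain r where r: "0 \<le> r" "?S = ennreal r"
  proof (cases ?S)
    case top
    then show thesis using less_imp_neq[OF S] by (simp only: infinity_ennreal_def)
  qed (rule that)
  have le: "(\<integral>\<^sup>+ x. ennreal ((norm (F (Complex x y)))\<^sup>2) \<partial>lebesgue) \<le>
      ennreal ((sqrt r)\<^sup>2)" if "0 < y" for y
  proof -
    have "(\<integral>\<^sup>+ x. ennreal ((norm (F (Complex x y)))\<^sup>2) \<partial>lebesgue) \<le> ?S"
      using that by (intro SUP_upper) simp
    then show ?thesis unfolding r(2) using r(1) by simp
  qed
  have meas: "(\<lambda>x. F (Complex x y)) \<in> borel_measurable lebesgue" if "0 < y" for y
    using continuous_on_Complex_horizontal[of F 0 y] hol that by (simp add: continuous_imp_measurable_lebesgue)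
  show thesis
    using L2I_nn_integral[OF meas _ le] L2_norm_le_nn_integral[OF meas _ le] r(1)
    by (intro that[of "sqrt r"]) auto
qed

text \<open>Let \<open>W\<close> be a primitive of \<open>F\<close>. By Cauchy--Schwarz \<open>W (z + s)
    - W z\<close> is bounded for \<open>s \<in> [0, 1]\<close>,
  hence so is its derivative \<open>F (z + s) - F z\<close> away from the real line. Comparing \<open>F
      z\<close> with
  \<open>W (z + 1) - W z\<close> then bounds \<open>F z\<close>.\<close>

lemma hardy_UHP_bounded:
  assumes F: "F \<in> hardy_UHP" and y: "0 < y0"
  obtains K where "\<And>z. y0 \<le> Im z \<Longrightarrow> norm (F z) \<le> K"
proof -
  have hol: "F holomorphic_on {z. 0 < Im z}"
    using F by (auto simp: hardy_UHP_def)
  obtain M where M: "0 \<le> M" "\<And>y. 0 < y \<Longrightarrow> (\<lambda>x. F (Complex x y)) \<in> L2"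
    "\<And>y. 0 < y \<Longrightarrow> L2_norm (\<lambda>x. F (Complex x y)) \<le> M"
    using hardy_UHP_L2_bound[OF F] by blast
  obtain W where W0: "\<And>z. z \<in> {z. 0 < Im z} \<Longrightarrow> (W has_field_derivative F z) (at z
      within {z. 0 < Im z})"
    using holomorphic_convex_primitive'[OF convex_Im_gt open_Im_gt hol] by blast
  then have W: "(W has_field_derivative F z) (at z)" if "0 < Im z" for z
    using W0[of z] that at_within_open[OF _ open_Im_gt, of z 0] by simp
  have W_diff: "norm (W (z + of_real s) - W z) \<le> M" if z: "0 < Im z" and s: "0 \<le> s" "s \<le> 1" for z s
  proof -
    define x where "x = Re z"
    define y where "y = Im z"
    have y: "0 < y" using z by (simp add: y_def)
    have cont: "continuous_on UNIV (\<lambda>x. F (Complex x y))"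
      using continuous_on_Complex_horizontal[of F 0 y] hol y by simp
    have "((\<lambda>t. W (Complex t y)) has_vector_derivative F (Complex t y)) (at t within {x..x + s})" for t
    proof -
      have "((\<lambda>u. W (u + \<i> * of_real y)) has_field_derivative F (Complex t y)) (at (of_real t))"
        using DERIV_shift[of W "F (Complex t y)" "of_real t" "\<i> * of_real y"] W[of "Complex t y"] y
        by (simp add: Complex_eq)
      from has_vector_derivative_real_field[OF this] show ?thesis by (simp add: Complex_eq)
    qed
    then have "(LINT t|lborel. indicator {x..x + s} t *\<^sub>R F (Complex t y)) = W (Complex (x + s) y)
        - W (Complex x y)"
      using s by (intro integral_FTC_Icc continuous_on_subset[OF cont]) auto
    moreover have "(\<lambda>t. indicator {x..x + s} t *\<^sub>R F (Complex t y)) \<in> borel_measurable lborel"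
      using borel_measurable_continuous_onI[OF cont] by simp
    ultimately have "W (Complex (x + s) y) - W (Complex x y) = (LINT t|lebesgue. indicator {x..x + s} t
        *\<^sub>R F (Complex t y))"
      by (simp add: integral_completion)
    also have "\<dots> = (LINT t|lebesgue. indicator {x..x + s} t * F (Complex t y))"
      by (intro Bochner_Integration.integral_cong) (auto simp: indicator_def)
    finally have eq: "W (Complex (x + s) y) - W (Complex x y) = (LINT t|lebesgue. indicator {x..x + s} t
        * F (Complex t y))" .
    have I: "{x..x + s} \<in> sets lebesgue" "emeasure lebesgue {x..x + s} < \<infinity>"
      using s by simp_all
    have "norm (W (Complex (x + s) y) - W (Complex x y)) \<le>
        L2_norm (\<lambda>t. indicator {x..x + s} t) * L2_norm (\<lambda>t. F (Complex t y))"
      unfolding eq by (intro norm_integral_mult_le_L2_norm indicator_L2[OF I] M(2)[OF y])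
    \<comment> \<open>The 1 bounds the norm of the indicator, the root of the length
      \<open>s\<close>.\<close>
    also have "\<dots> \<le> 1 * M"
      using s M(3)[OF y] unfolding L2_norm_indicator[OF I] by (intro mult_mono) auto
    finally have "norm (W (Complex (x + s) y) - W (Complex x y)) \<le> M" by simp
    moreover have "Complex (x + s) y = z + of_real s" "Complex x y = z"
      by (simp_all add: complex_eq_iff x_def y_def)
    ultimately show ?thesis by simp
  qed
  have F_diff: "norm (F (z + of_real s) - F z) \<le> M / (y0 / 2)" if z: "y0 \<le> Im z" and s: "0 \<le>
      s" "s \<le> 1" for z s
  proof -
    let ?D = "\<lambda>w. W (w + of_real s) - W w"
    \<comment> \<open>Radius \<open>y0 / 2\<close> keeps the disc of Cauchy's estimate inside the
      upper half plane.\<close>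
    have ball: "0 < Im w" if "w \<in> cball z (y0 / 2)" for w
    proof -
      have "Im (z - w) \<le> y0 / 2"
        using order_trans[OF abs_ge_self abs_Im_le_cmod[of "z - w"]] that by (simp add: dist_norm)
      then show ?thesis using z y by simp
    qed
    have D: "(?D has_field_derivative F (w + of_real s) - F w) (at w)" if "0 < Im w" for w
      using that DERIV_shift[of W "F (w + of_real s)" w "of_real s"] W[of "w + of_real s"]
      by (intro DERIV_diff W) auto
    have "norm ((deriv ^^ 1) ?D z) \<le> fact 1 * M / (y0 / 2) ^ 1"
    proof (rule Cauchy_inequality)
      show "?D holomorphic_on ball z (y0 / 2)"
        unfolding holomorphic_on_def field_differentiable_def
        by (intro ballI exI, rule has_field_derivative_at_within[OF D[OF ball]]) simp
      show "continuous_on (cball z (y0 / 2)) ?D"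
        by (intro continuous_at_imp_continuous_on ballI DERIV_isCont[OF D[OF ball]])
      show "norm (?D w) \<le> M" if "norm (z - w) = y0 / 2" for w
        using that s by (intro W_diff ball) (auto simp: dist_norm)
    qed (use y in simp)
    moreover have "deriv ?D z = F (z + of_real s) - F z"
      using z y by (intro DERIV_imp_deriv D) simp
    ultimately show ?thesis by simp
  qed
  have "norm (F z) \<le> M + M / (y0 / 2)" if z: "y0 \<le> Im z" for z
  proof -
    \<comment> \<open>Removing the linear part leaves the derivative \<open>F w - F z\<close>,
      already bounded on the segment from \<open>z\<close> to \<open>z + 1\<close>. The increment of
      the removed part over this segment is exactly \<open>F z\<close>.\<close>
    let ?\<phi> = "\<lambda>w. W w - F z * w"
    have seg: "\<exists>s. w = z + of_real s \<and> 0 \<le> s \<and> s \<le> 1" if "w \<in>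
        closed_segment z (z + 1)" for w
      using that by (auto simp: in_segment algebra_simps scaleR_conv_of_real)
    have "norm (?\<phi> (z + 1) - ?\<phi> z) \<le> M / (y0 / 2) * norm (z + 1 - z)"
    proof (rule field_differentiable_bound[where S="closed_segment z (z + 1)" and f'="\<lambda>w. F w - F z"])
      fix w assume "w \<in> closed_segment z (z + 1)"
      then obtain s where s: "w = z + of_real s" "0 \<le> s" "s \<le> 1" using seg by blast
      show "norm (F w - F z) \<le> M / (y0 / 2)" using F_diff[OF z s(2,3)] s(1) by simp
      show "(?\<phi> has_field_derivative F w - F z) (at w within closed_segment z (z + 1))"
        using s z y by (auto intro!: derivative_eq_intros DERIV_subset[OF W])
    qed auto
    moreover have "norm (W (z + of_real 1) - W z) \<le> M" using z y by (intro W_diff) auto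
    moreover have "F z = (W (z + 1) - W z) - (?\<phi> (z + 1) - ?\<phi> z)" by (simp add: algebra_simps)
    ultimately show ?thesis
      using norm_triangle_ineq4[of "W (z + 1) - W z" "?\<phi> (z + 1) - ?\<phi> z"] by simp
  qed
  then show thesis by (rule that)
qed

text \<open>The factor \<open>1 / (1 - \<i> \<epsilon> z)\<close> supplies the decay that
    \<open>F\<close>, being merely bounded, does not have.\<close>

lemma hardy_UHP_orthogonal:
  assumes F: "F \<in> hardy_UHP" and G: "G \<in> regular_UHP" and y: "0 < y"
  shows "(LINT x|lebesgue. F (Complex x y) * G (of_real x)) = 0"
proof -
  have hol: "F holomorphic_on {z. 0 < Im z}"
    using F by (auto simp: hardy_UHP_def)
  obtain K where K: "\<And>z. y / 2 \<le> Im z \<Longrightarrow> norm (F z) \<le> K"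
    using hardy_UHP_bounded[OF F half_gt_zero[OF y]] by blast
  have FL2: "(\<lambda>x. F (Complex x y)) \<in> L2"
    using hardy_UHP_L2_bound[OF F] y by blast
  obtain \<delta> C where \<delta>: "0 < \<delta>" and G_hol: "G holomorphic_on {z. - \<delta> < Im z}"
      and C: "0 \<le> C"
    "\<And>z. 0 \<le> Im z \<Longrightarrow> z \<noteq> 0 \<Longrightarrow> norm (G z) \<le> C / norm z"
    using regular_UHPE[OF G] by metis
  have K0: "0 \<le> K" using order_trans[OF norm_ge_zero K[of "\<i> * of_real y"]] y by simp
  define \<epsilon> where "\<epsilon> n = inverse (real (Suc n))" for n
  have \<epsilon>: "0 < \<epsilon> n" "\<epsilon> n \<le> 1" for n by (auto simp: \<epsilon>_def
      inverse_le_1_iff)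
  let ?d = "\<lambda>n z. 1 - \<i> * of_real (\<epsilon> n) * z"
  have Re_d: "Re (?d n z) = 1 + \<epsilon> n * Im z" for n z by simp
  let ?Q = "\<lambda>n z. F (z + \<i> * of_real y) * G z / ?d n z"
  have Q0: "(LINT x|lebesgue. ?Q n (of_real x)) = 0" for n
  proof (rule integral_half_plane_decay)
    \<comment> \<open>The three widths serve \<open>G\<close>, the shifted \<open>F\<close>, and the
      denominator: with \<open>\<epsilon> n \<le> 1\<close> and \<open>Im z > -1\<close> its real
      part \<open>1 + \<epsilon> n * Im z\<close> stays positive.\<close>
    let ?\<delta> = "min \<delta> (min (y / 2) 1)"
    have "?d n z \<noteq> 0" if "- ?\<delta> < Im z" for z
    proof -
      have "- 1 < \<epsilon> n * Im z"
      proof (cases "0 \<le> Im z")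
        case False
        then have "\<epsilon> n * (- Im z) \<le> 1 * (- Im z)" using \<epsilon> by (intro mult_right_mono) auto
        then show ?thesis using that by simp
      qed (use \<epsilon>[of n] in \<open>auto intro: less_le_trans[of _ 0]\<close>)
      then have "Re (?d n z) \<noteq> 0" unfolding Re_d by simp
      then show ?thesis by (metis zero_complex.sel(1))
    qed
    moreover have "(\<lambda>z. F (z + \<i> * of_real y)) holomorphic_on {z. - ?\<delta> < Im z}"
      using y by (intro holomorphic_on_compose_gen[OF _ hol, unfolded o_def] holomorphic_intros) auto
    ultimately show "?Q n holomorphic_on {z. - ?\<delta> < Im z}"
      by (intro holomorphic_intros holomorphic_on_subset[OF G_hol]) auto
    show "0 < ?\<delta>" using \<delta> y by simp
    \<comment> \<open>The threshold \<open>2 / \<epsilon> n\<close> makes the 1 in the denominator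
      at most half of \<open>\<epsilon> n * norm z\<close>; \<open>F\<close> contributes
      \<open>K\<close>, and \<open>G\<close> and the damping factor one power of
      \<open>1 / norm z\<close> each.\<close>
    show "norm (?Q n z) \<le> (2 * K * C / \<epsilon> n) / (norm z)\<^sup>2" if z: "0 \<le> Im z" "2 /
        \<epsilon> n \<le> norm z" for z
    proof -
      have "0 < norm z" using z(2) \<epsilon>[of n] by (auto intro: less_le_trans[of 0 "2 / \<epsilon> n"])
      have "2 \<le> \<epsilon> n * norm z" using z(2) \<epsilon>[of n] by (simp add: pos_divide_le_eq
          mult.commute)
      then have d: "\<epsilon> n * norm z / 2 \<le> norm (?d n z)"
        using norm_triangle_ineq2[of "\<i> * of_real (\<epsilon> n) * z" 1] \<epsilon>[of n] by (simp
            add: norm_mult norm_minus_commute)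
      have "norm (?Q n z) \<le> K * (C / norm z) / (\<epsilon> n * norm z / 2)"
        unfolding norm_divide norm_mult using z y K0 C \<epsilon>[of n] \<open>0 < norm z\<close>
        by (intro frac_le mult_mono K C(2) d) auto
      then show ?thesis by (simp add: power2_eq_square mult_ac)
    qed
  qed
  have lim: "(\<lambda>n. LINT x|lebesgue. ?Q n (of_real x)) \<longlonglongrightarrow> (LINT x|lebesgue.
      F (Complex x y) * G (of_real x))"
  proof (rule integral_dominated_convergence)
    have *: "of_real x + \<i> * of_real y = Complex x y" for x by (simp add: Complex_eq)
    show int: "integrable lebesgue (\<lambda>x. norm (F (Complex x y) * G (of_real x)))"
      by (intro integrable_norm integrable_L2_mult FL2 regular_UHP_L2_real G)
    show "(\<lambda>x. F (Complex x y) * G (of_real x)) \<in> borel_measurable lebesgue"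
      by (intro borel_measurable_times L2_measurable FL2 regular_UHP_L2_real G)
    then show "(\<lambda>x. ?Q n (of_real x)) \<in> borel_measurable lebesgue" for n
      unfolding * by (rule borel_measurable_divide) (intro continuous_imp_measurable_lebesgue continuous_intros)
    show "AE x in lebesgue. (\<lambda>n. ?Q n (of_real x)) \<longlonglongrightarrow> F (Complex x y) * G
        (of_real x)"
    proof (rule AE_I2)
      fix x
      have "(\<lambda>n. F (Complex x y) * G (of_real x) / ?d n (of_real x)) \<longlonglongrightarrow>
          F (Complex x y) * G (of_real x) / (1 - \<i> * of_real 0 * of_real x)"
        unfolding \<epsilon>_def by (intro tendsto_intros LIMSEQ_inverse_real_of_nat) simp
      then show "(\<lambda>n. ?Q n (of_real x)) \<longlonglongrightarrow> F (Complex x y) * G (of_real x)"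
        unfolding * by simp
    qed
    show "AE x in lebesgue. norm (?Q n (of_real x)) \<le> norm (F (Complex x y) * G (of_real x))" for n
    proof (rule AE_I2)
      fix x
      have "1 \<le> norm (?d n (of_real x))"
        using complex_Re_le_cmod[of "?d n (of_real x)"] by simp
      then have "norm (F (Complex x y) * G (of_real x)) / norm (?d n (of_real x)) \<le> norm (F (Complex
          x y) * G (of_real x)) / 1"
        by (intro divide_left_mono) auto
      then show "norm (?Q n (of_real x)) \<le> norm (F (Complex x y) * G (of_real x))"
        unfolding * norm_divide by simp
    qed
  qed
  show ?thesis using LIMSEQ_unique[OF lim] Q0 by simp
qed

text \<open>The pairing carries no conjugate, so this is orthogonality of \<open>h\<close> to
  \<open>cnj G\<close>. Only \<open>F\<close> is lifted to height \<open>y\<close>, \<open>G\<close>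
  stays on the real line; then \<open>y\<close> tends to 0 by Cauchy-Schwarz.\<close>

lemma hardy_H2_orthogonal:
  assumes h: "h \<in> hardy_H2" and G: "G \<in> regular_UHP"
  shows "(LINT x|lebesgue. h x * G (of_real x)) = 0"
proof -
  obtain F where F: "F \<in> hardy_UHP" and hL2: "h \<in> L2"
    and lim: "((\<lambda>y. L2_norm (\<lambda>x. F (Complex x y) - h x)) \<longlongrightarrow> 0) (at_right 0)"
    using h by (auto simp: hardy_H2_def)
  let ?I = "LINT x|lebesgue. h x * G (of_real x)"
  have "norm ?I \<le> L2_norm (\<lambda>x. F (Complex x y) - h x) * L2_norm (\<lambda>x. G (of_real x))"
      if y: "0 < y" for y
  proof -
    have FL2: "(\<lambda>x. F (Complex x y)) \<in> L2" using hardy_UHP_L2_bound[OF F] y by blast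
    note GL2 = regular_UHP_L2_real[OF G]
    have "(LINT x|lebesgue. (F (Complex x y) - h x) * G (of_real x)) = 0 - ?I"
      unfolding left_diff_distrib hardy_UHP_orthogonal[OF F G y, symmetric]
      by (intro Bochner_Integration.integral_diff integrable_L2_mult FL2 GL2 hL2)
    then show ?thesis
      using norm_integral_mult_le_L2_norm[OF L2_diff[OF FL2 hL2] GL2] by simp
  qed
  then have "\<forall>\<^sub>F y in at_right 0. norm ?I \<le> L2_norm (\<lambda>x. F (Complex x y) - h x)
      * L2_norm (\<lambda>x. G (of_real x))"
    using eventually_at_right_less[of 0] by (auto elim!: eventually_mono)
  moreover have "((\<lambda>y. L2_norm (\<lambda>x. F (Complex x y) - h x) * L2_norm (\<lambda>x. G
      (of_real x))) \<longlongrightarrow> 0) (at_right 0)"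
    by (rule tendsto_mult_left_zero[OF lim])
  ultimately have "norm ?I \<le> 0"
    by (intro tendsto_lowerbound) auto
  then show ?thesis by simp
qed

text \<open>Multiplication by a fixed strictly positive weight in \<open>L\<^sup>2\<close> turns an
    \<open>L\<^sup>2\<close>-Cauchy sequence into an
  \<open>L\<^sup>1\<close>-Cauchy one, which has an a.e. convergent subsequence.\<close>

lemma L2_complete:
  assumes s: "\<And>n. s n \<in> L2"
    and cau: "\<And>e. 0 < e \<Longrightarrow> \<exists>N. \<forall>m\<ge>N. \<forall>n\<ge>N. L2_norm
        (\<lambda>x. s m x - s n x) < e"
  obtains f where "f \<in> L2" "(\<lambda>n. L2_norm (\<lambda>x. s n x - f x)) \<longlonglongrightarrow> 0"
proof -
  let ?w = "decay_weight 1"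
  have w_ne: "?w x \<noteq> 0" for x
    by (simp add: decay_weight_def add_nonneg_eq_0_iff)
  have "\<exists>N. \<forall>i\<ge>N. \<forall>j\<ge>N. (LINT x|lebesgue. norm (s i x * ?w x - s j x * ?w
      x)) < e" if "0 < e" for e
  proof -
    let ?c = "L2_norm ?w + 1"
    have c: "0 < ?c" by (simp add: add_nonneg_pos)
    obtain N where N: "\<And>i j. N \<le> i \<Longrightarrow> N \<le> j \<Longrightarrow> L2_norm
        (\<lambda>x. s i x - s j x) < e / ?c"
      using cau[of "e / ?c"] \<open>0 < e\<close> c by auto
    have "(LINT x|lebesgue. norm (s i x * ?w x - s j x * ?w x)) < e" if "N \<le> i" "N \<le> j" for i j
    proof -
      have "(LINT x|lebesgue. norm (s i x * ?w x - s j x * ?w x)) \<le> L2_norm (\<lambda>x. s i x - s j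
          x) * L2_norm ?w"
        using integral_norm_mult_le_L2_norm[OF L2_diff[OF s s] decay_weight_L2] by (simp add: left_diff_distrib)
      also have "\<dots> \<le> L2_norm (\<lambda>x. s i x - s j x) * ?c" by (intro mult_left_mono) auto
      also have "\<dots> < e" using N[OF that] c by (simp add: pos_less_divide_eq)
      finally show ?thesis .
    qed
    then show ?thesis by blast
  qed
  then obtain r where r: "strict_mono r" and ae: "AE x in lebesgue. Cauchy (\<lambda>i. s (r i) x * ?w x)"
    using cauchy_L1_AE_cauchy_subseq[of lebesgue "\<lambda>n x. s n x * ?w x"] integrable_L2_mult[OF s
        decay_weight_L2]
    by blast
  define f where "f x = lim (\<lambda>i. s (r i) x)" for x
  have lim: "AE x in lebesgue. (\<lambda>i. s (r i) x) \<longlonglongrightarrow> f x"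
    using ae
  proof eventually_elim
    case (elim x)
    then obtain l where "(\<lambda>i. s (r i) x * ?w x) \<longlonglongrightarrow> l"
      by (auto simp: Cauchy_convergent_iff convergent_def)
    then have "(\<lambda>i. s (r i) x * ?w x / ?w x) \<longlonglongrightarrow> l / ?w x" using w_ne by
        (intro tendsto_intros)
    then have "convergent (\<lambda>i. s (r i) x)" using w_ne by (auto simp: convergent_def)
    then show ?case unfolding f_def by (simp add: convergent_LIMSEQ_iff)
  qed
  have f_meas: "f \<in> borel_measurable lebesgue"
    unfolding f_def using L2_measurable[OF s] by (intro borel_measurable_lim_metric)
  \<comment> \<open>Fatou along the subsequence replaces \<open>s m\<close> by its limit in a Cauchy
    estimate. Shifting the index by \<open>N\<close> suffices because \<open>r i\<close> is at least
    \<open>i\<close>.\<close>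
  have conv: "(\<lambda>x. f x - s n x) \<in> L2 \<and> L2_norm (\<lambda>x. f x - s n x) \<le> e"
    if N: "\<And>m. N \<le> m \<Longrightarrow> L2_norm (\<lambda>x. s m x - s n x) < e" for N n e
  proof (rule L2_norm_Fatou[of "\<lambda>i x. s (r (i + N)) x - s n x"])
    show "AE x in lebesgue. (\<lambda>i. s (r (i + N)) x - s n x) \<longlonglongrightarrow> f x - s n x"
      using lim by eventually_elim (intro tendsto_diff tendsto_const LIMSEQ_ignore_initial_segment)
    show "L2_norm (\<lambda>x. s (r (i + N)) x - s n x) \<le> e" for i
      using N[of "r (i + N)"] seq_suble[OF r, of "i + N"] by simp
  qed (use s f_meas L2_measurable[OF s] in \<open>auto intro!: L2_diff\<close>)
  have f: "f \<in> L2"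
  proof -
    obtain N where "\<And>m. N \<le> m \<Longrightarrow> L2_norm (\<lambda>x. s m x - s N x) < 1" using
        cau[of 1] by auto
    then have "(\<lambda>x. f x - s N x) \<in> L2" using conv by blast
    from L2_add[OF this s[of N]] show ?thesis by simp
  qed
  have "(\<lambda>n. L2_norm (\<lambda>x. s n x - f x)) \<longlonglongrightarrow> 0"
  proof (rule LIMSEQ_I)
    fix e :: real assume e: "0 < e"
    obtain N where N: "\<And>m n. N \<le> m \<Longrightarrow> N \<le> n \<Longrightarrow> L2_norm
        (\<lambda>x. s m x - s n x) < e / 2"
      using cau[OF half_gt_zero[OF e]] by blast
    have "L2_norm (\<lambda>x. s n x - f x) < e" if "N \<le> n" for n
      using conv[of N n "e / 2"] N[OF _ that] e L2_norm_minus_commute[of f "s n"] by simp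
    then show "\<exists>no. \<forall>n\<ge>no. norm (L2_norm (\<lambda>x. s n x - f x) - 0) < e" by auto
  qed
  with f show thesis by (rule that)
qed

section \<open>Explicit regular functions built from simple poles\<close>

lemma regular_UHP_inverse:
  assumes "Im a < 0" shows "(\<lambda>z. 1 / (z - a)) \<in> regular_UHP"
proof (rule regular_UHPI)
  show "(\<lambda>z. 1 / (z - a)) holomorphic_on {z. - (- Im a) < Im z}"
    by (intro holomorphic_intros) auto
  show "norm (1 / (z - a)) * norm z \<le> 2" if "2 * norm a + 1 \<le> norm z" for z
  proof -
    have "norm z / 2 \<le> norm (z - a)" using norm_triangle_ineq2[of z a] that by simp
    moreover have "0 < norm z" using that norm_ge_zero[of a] by linarith
    ultimately show ?thesis by (simp add: norm_divide divide_le_eq)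
  qed
qed (use assms in simp)

text \<open>The numerator vanishes at \<open>a\<close>, so the singularity is removable. For
  \<open>k \<ge> 0\<close> the exponential has norm at most 1 on the closed half plane, so the
  quotient decays like \<open>4 / norm z\<close>.\<close>

lemma regular_UHP_exp_quotient:
  assumes a: "0 < Im a" and k: "0 \<le> k"
  obtains G where "G \<in> regular_UHP"
    "\<And>x. G (of_real x) = (exp (\<i> * of_real (k * x)) - exp (\<i> * of_real k * a)) / (of_real x - a)"
proof
  let ?e = "\<lambda>z. exp (\<i> * of_real k * z)"
  let ?G = "\<lambda>z. if z = a then deriv ?e a else (?e z - ?e a) / (z - a)"
  show "?G \<in> regular_UHP"
  proof (rule regular_UHPI)
    show "?G holomorphic_on {z. - 1 < Im z}"
      using a by (intro pole_lemma holomorphic_intros) (simp add: interior_open open_Im_gt)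
    have e_le: "norm (?e z) \<le> 1" if "0 \<le> Im z" for z
      using that k by (simp add: norm_exp_eq_Re)
    show "norm (?G z) * norm z \<le> 4" if "2 * norm a + 1 \<le> norm z" "0 \<le> Im z" for z
    proof -
      have z: "norm z / 2 \<le> norm (z - a)" using norm_triangle_ineq2[of z a] that by simp
      have pos: "0 < norm z" using that norm_ge_zero[of a] by linarith
      have "norm (?e z - ?e a) \<le> 2"
        using norm_triangle_ineq4[of "?e z" "?e a"] e_le[OF that(2)] e_le[OF less_imp_le[OF a]] by linarith
      then have "norm (?e z - ?e a) / norm (z - a) \<le> 2 / (norm z / 2)"
        using z pos by (intro frac_le) auto
      moreover have "z \<noteq> a" using z pos by auto
      ultimately show ?thesis using pos by (simp add: norm_divide pos_le_divide_eq)
    qed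
  qed simp
  show "?G (of_real x) = (exp (\<i> * of_real (k * x)) - exp (\<i> * of_real k * a)) / (of_real x - a)" for x
    using a by (auto simp: mult.assoc)
qed

section \<open>Density of simple poles\<close>

text \<open>Density of the poles is needed for two different approximation properties; the locale
  lets one argument serve both. \<open>limit\<close> asks for \<open>f \<in> L2\<close> separately
  because \<open>L2_norm\<close> does not detect it; with constant sequences it also saturates
  \<open>V\<close> under a.e. equality.\<close>

locale closed_L2_subspace =
  fixes V :: "(real \<Rightarrow> complex) set"
  assumes subset_L2: "f \<in> V \<Longrightarrow> f \<in> L2"
    and zero: "(\<lambda>x. 0) \<in> V"
    and add: "f \<in> V \<Longrightarrow> g \<in> V \<Longrightarrow> (\<lambda>x. f x + g x) \<in> V"
    and scale: "f \<in> V \<Longrightarrow> (\<lambda>x. c * f x) \<in> V"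
    and limit: "(\<And>n. s n \<in> V) \<Longrightarrow> f \<in> L2 \<Longrightarrow> (\<lambda>n.
        L2_norm (\<lambda>x. s n x - f x)) \<longlonglongrightarrow> 0 \<Longrightarrow> f \<in> V"
begin

lemma diff: "f \<in> V \<Longrightarrow> g \<in> V \<Longrightarrow> (\<lambda>x. f x - g x) \<in> V"
  using add[of f "\<lambda>x. (-1) * g x"] scale[of g "-1"] by simp

lemma sum: "(\<And>i. i \<in> I \<Longrightarrow> f i \<in> V) \<Longrightarrow> (\<lambda>x.
    \<Sum>i\<in>I. f i x) \<in> V"
  by (induction I rule: infinite_finite_induct) (simp_all add: zero add)

lemma dominated_limit:
  assumes "\<And>n. s n \<in> V" "w \<in> L2" "f \<in> borel_measurable lebesgue"
    "AE x in lebesgue. (\<lambda>n. s n x) \<longlonglongrightarrow> f x" "\<And>n x. norm (s n x) \<le>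
        norm (w x)"
  shows "f \<in> V"
proof -
  have s: "s n \<in> borel_measurable lebesgue" for n
    by (intro L2_measurable subset_L2 assms)
  show ?thesis
    using limit[OF assms(1) L2_dominated_limit[OF assms(2) s assms(3-5)]
      L2_dominated_convergence[OF assms(2) s assms(3-5)]] .
qed

end

section \<open>Riemann sums of Poisson kernels\<close>

text \<open>\<open>arctan ((t - x) / y) / pi\<close> is a primitive of the kernel in
  \<open>t\<close>. Two uses of the mean value theorem leave \<open>h^2\<close> times a derivative
  of the kernel, which is at most \<open>1 / y^2\<close> because
  \<open>2 * y * \<bar>u - x\<bar> \<le> (u - x)^2 + y^2\<close>.\<close>

lemma poisson_kernel_increment:
  assumes y: "0 < y" and h: "0 < h"
  shows "\<bar>(arctan ((t + h - x) / y) - arctan ((t - x) / y)) / pi - h * poisson_kernel y x t\<bar>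
      \<le> h\<^sup>2 / y\<^sup>2"
proof -
  let ?D = "\<lambda>u. (u - x)\<^sup>2 + y\<^sup>2"
  let ?p' = "\<lambda>u. - (2 * y * (u - x) / (pi * (?D u)\<^sup>2))"
  have D: "0 < ?D u" for u using y by (simp add: add_nonneg_pos)
  have 1: "((\<lambda>u. arctan ((u - x) / y) / pi) has_real_derivative poisson_kernel y x u) (at u)" for u
  proof -
    have "1 + ((u - x) / y)\<^sup>2 = ?D u / y\<^sup>2" using y by (simp add: field_simps)
    then have "inverse (1 + ((u - x) / y)\<^sup>2) * (1 / y) / pi = poisson_kernel y x u"
      using y by (simp add: poisson_kernel_def field_simps power2_eq_square)
    moreover have "((\<lambda>u. arctan ((u - x) / y) / pi) has_real_derivative inverse (1 + ((u - x) /
        y)\<^sup>2) * (1 / y) / pi) (at u)"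
      using y by (auto intro!: derivative_eq_intros)
    ultimately show ?thesis by simp
  qed
  have 2: "(poisson_kernel y x has_real_derivative ?p' u) (at u)" for u
  proof -
    have eq: "poisson_kernel y x = (\<lambda>u. y / pi * inverse (?D u))"
      by (simp add: fun_eq_iff poisson_kernel_def divide_inverse)
    have "(?D has_real_derivative 2 * (u - x)) (at u)"
      by (auto intro!: derivative_eq_intros)
    moreover have "?D u \<noteq> 0" using D[of u] by (rule less_imp_neq[THEN not_sym])
    ultimately have "((\<lambda>u. y / pi * inverse (?D u)) has_real_derivative
        y / pi * - (inverse (?D u) * (2 * (u - x)) * inverse (?D u))) (at u)"
      by (intro DERIV_cmult DERIV_inverse')
    then
    have "(poisson_kernel y x has_real_derivative y / pi * - (inverse (?D u) * (2 * (u - x)) * inverse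
        (?D u))) (at u)"
      unfolding eq .
    moreover have "y / pi * - (inverse d * (2 * w) * inverse d) = - (2 * y * w / (pi * d\<^sup>2))" for d w
      by (simp add: power2_eq_square divide_inverse)
    ultimately show ?thesis by (simp only:)
  qed
  have 3: "\<bar>?p' u\<bar> \<le> 1 / y\<^sup>2" for u
  proof -
    have "2 * y * \<bar>u - x\<bar> \<le> ?D u"
      using sum_squares_bound[of y "\<bar>u - x\<bar>"] unfolding power2_abs by linarith
    then have "2 * y * \<bar>u - x\<bar> / (pi * (?D u)\<^sup>2) \<le> ?D u / (pi * (?D u)\<^sup>2)"
      by (intro divide_right_mono) auto
    also have "\<dots> = 1 / (pi * ?D u)" using D[of u] by (simp add: power2_eq_square)
    also have "\<dots> \<le> 1 / (1 * y\<^sup>2)"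
      using y pi_gt3 by (intro divide_left_mono mult_mono mult_pos_pos D) auto
    finally have "2 * y * \<bar>u - x\<bar> / (pi * (?D u)\<^sup>2) \<le> 1 / y\<^sup>2" by simp
    moreover have "\<bar>2 * y * (u - x) / (pi * (?D u)\<^sup>2)\<bar> = 2 * y * \<bar>u - x\<bar> / (pi
        * (?D u)\<^sup>2)"
      unfolding abs_divide abs_mult abs_power2 abs_numeral using y pi_gt_zero by (simp only: abs_of_pos)
    ultimately show ?thesis by (simp only: abs_minus_cancel)
  qed
  obtain z where z: "t < z" "z < t + h"
    "arctan ((t + h - x) / y) / pi - arctan ((t - x) / y) / pi = (t + h - t) * poisson_kernel y x z"
    using MVT2[of t "t + h" "\<lambda>u. arctan ((u - x) / y) / pi" "poisson_kernel y x"] 1 h by auto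
  obtain v where v: "poisson_kernel y x z - poisson_kernel y x t = (z - t) * ?p' v"
    using MVT2[OF z(1), of "poisson_kernel y x" ?p'] 2 by blast
  have "(arctan ((t + h - x) / y) - arctan ((t - x) / y)) / pi - h * poisson_kernel y x t
      = h * ((z - t) * ?p' v)"
    unfolding v[symmetric] using z(3) by (simp add: diff_divide_distrib right_diff_distrib)
  moreover have "\<bar>h * ((z - t) * ?p' v)\<bar> \<le> h * (h * (1 / y\<^sup>2))"
    unfolding abs_mult using z(1,2) h 3 by (intro mult_mono) auto
  moreover have "h * (h * (1 / y\<^sup>2)) = h\<^sup>2 / y\<^sup>2" by (simp add: power2_eq_square)
  ultimately show ?thesis by (simp only:)
qed

text \<open>Puts the kernel, read as a function of \<open>x\<close>, into every subspace that
  contains the simple poles: the coefficient does not involve \<open>x\<close>, and the poles lie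
  off the real line.\<close>

lemma poisson_kernel_partial_fractions:
  assumes "0 < y"
  shows "complex_of_real (poisson_kernel y x t) =
    1 / (2 * pi * \<i>) * (1 / (of_real x - Complex t y) - 1 / (of_real x - Complex t (- y)))"
proof -
  have ne: "of_real x - Complex t y \<noteq> 0" "of_real x - Complex t (- y) \<noteq> 0"
    using assms by (auto simp: complex_eq_iff)
  have "(of_real x - Complex t y) * (of_real x - Complex t (- y)) = of_real ((t - x)\<^sup>2 + y\<^sup>2)"
    by (simp add: complex_eq_iff power2_eq_square algebra_simps)
  moreover have "(of_real x - Complex t (- y)) - (of_real x - Complex t y) = 2 * \<i> * of_real y"
    by (simp add: complex_eq_iff)
  moreover have "1 / p - 1 / q = s / r" if "p \<noteq> 0" "q \<noteq> 0" "p * q = r" "q - p = s" for p q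
      r s :: complex
    unfolding that(3,4)[symmetric] using that(1,2) by (simp add: diff_frac_eq)
  ultimately have "1 / (of_real x - Complex t y) - 1 / (of_real x - Complex t (- y)) =
      2 * \<i> * of_real y / of_real ((t - x)\<^sup>2 + y\<^sup>2)"
    using ne by blast
  then show ?thesis by (simp add: poisson_kernel_def)
qed

text \<open>The height \<open>1 / (n + 1)\<close> of the kernels and the much finer mesh \<open>(b - a) /
    (n + 1) ^ 3\<close> vanish
  simultaneously: the error of the Riemann sum is at most mesh times length over the square of the
      height.\<close>

definition poisson_riemann_sum :: "real \<Rightarrow> real \<Rightarrow> nat \<Rightarrow> real
    \<Rightarrow> real" where
  "poisson_riemann_sum a b n x = (\<Sum>j<Suc n ^ 3. (b - a) / real (Suc n ^ 3) *
     poisson_kernel (inverse (real (Suc n))) x (a + real j * ((b - a) / real (Suc n ^ 3))))"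

text \<open>The primitive telescopes over the mesh and \<open>poisson_kernel_increment\<close> is
  paid once per cell. The cube in the number of cells outweighs the squared height and leaves a
  single factor \<open>1 / (n + 1)\<close>.\<close>

lemma poisson_riemann_sum_error:
  assumes "a < b"
  shows "\<bar>(arctan ((b - x) * real (Suc n)) - arctan ((a - x) * real (Suc n))) / pi -
      poisson_riemann_sum a b n x\<bar>
    \<le> (b - a)\<^sup>2 * inverse (real (Suc n))"
proof -
  define M where "M = Suc n ^ 3"
  define y where "y = inverse (real (Suc n))"
  define h where "h = (b - a) / real M"
  have M: "0 < M" by (simp add: M_def)
  have y: "0 < y" by (simp add: y_def)
  have h: "0 < h" using assms M by (simp add: h_def)
  let ?t = "\<lambda>j. a + real j * h"
  let ?A = "\<lambda>t. arctan ((t - x) / y) / pi"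
  have "?A b - ?A a = (\<Sum>j<M. ?A (?t (Suc j)) - ?A (?t j))"
    using M by (subst sum_lessThan_telescope) (simp add: h_def)
  moreover have "poisson_riemann_sum a b n x = (\<Sum>j<M. h * poisson_kernel y x (?t j))"
    by (simp add: poisson_riemann_sum_def M_def h_def y_def)
  ultimately have "\<bar>(?A b - ?A a) - poisson_riemann_sum a b n x\<bar>
      = \<bar>\<Sum>j<M. (?A (?t (Suc j)) - ?A (?t j)) - h * poisson_kernel y x (?t j)\<bar>"
    by (simp add: sum_subtractf)
  also have "\<dots> \<le> (\<Sum>j<M. h\<^sup>2 / y\<^sup>2)"
  proof (rule order_trans[OF sum_abs sum_mono])
    fix j
    have eq: "?t (Suc j) = ?t j + h" by (simp add: algebra_simps)
    show "\<bar>?A (?t (Suc j)) - ?A (?t j) - h * poisson_kernel y x (?t j)\<bar> \<le> h\<^sup>2 / y\<^sup>2"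
      unfolding eq using poisson_kernel_increment[OF y h, of "?t j" x] by (simp only: diff_divide_distrib)
  qed
  also have "\<dots> = (b - a)\<^sup>2 * inverse (real (Suc n))"
  proof -
    have "r ^ 3 * ((d / r ^ 3)\<^sup>2 / (inverse r)\<^sup>2) = d\<^sup>2 * inverse r" if "0 < r" for d r
        :: real
      using that by (simp add: field_simps eval_nat_numeral)
    from this[of "real (Suc n)" "b - a"] show ?thesis
      by (simp add: h_def y_def M_def del: of_nat_Suc power_Suc)
  qed
  finally show ?thesis by (simp add: y_def divide_inverse left_diff_distrib)
qed

text \<open>The two arctangents tend to opposite values exactly when \<open>x\<close> lies between
  \<open>a\<close> and \<open>b\<close>. At an endpoint one of them vanishes and the limit would be
  1/2, hence the exclusions.\<close>

lemma poisson_riemann_sum_tendsto: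
  assumes "a < b" "x \<noteq> a" "x \<noteq> b"
  shows "(\<lambda>n. poisson_riemann_sum a b n x) \<longlonglongrightarrow> indicator {a..b} x"
proof -
  have lim: "filterlim (\<lambda>n. real (Suc n)) at_top sequentially"
    by (intro filterlim_compose[OF filterlim_real_sequentially] filterlim_Suc)
  have at: "(\<lambda>n. arctan (c * real (Suc n))) \<longlonglongrightarrow> sgn c * (pi / 2)" if "c
      \<noteq> 0" for c
  proof (cases "0 < c")
    case True
    then show ?thesis
      using filterlim_compose[OF tendsto_arctan_at_top filterlim_tendsto_pos_mult_at_top[OF tendsto_const
          True lim]]
      by simp
  next
    case False
    then show ?thesis
      using filterlim_compose[OF tendsto_arctan_at_bot filterlim_tendsto_neg_mult_at_bot[OF tendsto_const
          _ lim], of c] that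
      by simp
  qed
  have "(\<lambda>n. (arctan ((b - x) * real (Suc n)) - arctan ((a - x) * real (Suc n))) / pi)
      \<longlonglongrightarrow>
      (sgn (b - x) * (pi / 2) - sgn (a - x) * (pi / 2)) / pi"
    using assms by (intro tendsto_intros at) auto
  moreover have "(sgn (b - x) * (pi / 2) - sgn (a - x) * (pi / 2)) / pi = indicator {a..b} x"
    using assms by (auto simp: indicator_def sgn_if field_simps)
  ultimately have 1: "(\<lambda>n. (arctan ((b - x) * real (Suc n)) - arctan ((a - x) * real (Suc n))) /
      pi) \<longlonglongrightarrow> indicator {a..b} x"
    by simp
  have "(\<lambda>n. (b - a)\<^sup>2 * inverse (real (Suc n))) \<longlonglongrightarrow> 0"
    by (intro tendsto_mult_right_zero LIMSEQ_inverse_real_of_nat)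
  then have "(\<lambda>n. (arctan ((b - x) * real (Suc n)) - arctan ((a - x) * real (Suc n))) / pi -
      poisson_riemann_sum a b n x) \<longlonglongrightarrow> 0"
    by (rule Lim_null_comparison[rotated]) (use poisson_riemann_sum_error[OF assms(1)] in simp)
  from tendsto_diff[OF 1 this] show ?thesis by simp
qed

text \<open>A majorant independent of \<open>n\<close>, as dominated convergence in
  \<open>L2\<close> requires. Near the interval the sum is compared with its arctangent limit form,
  far away each kernel is estimated directly.\<close>

lemma poisson_riemann_sum_bound:
  assumes "a < b"
  obtains C where "0 \<le> C" "\<And>n x. \<bar>poisson_riemann_sum a b n x\<bar> \<le> C * sqrt (inverse
      (1 + x\<^sup>2))"
proof -
  \<comment> \<open>For \<open>\<bar>x\<bar> > R\<close> every \<open>t\<close> in the interval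
    satisfies \<open>\<bar>t - x\<bar> \<ge> \<bar>x\<bar> / 2\<close>, so the kernel is at most
    \<open>4 / x^2\<close>; with \<open>1 + x^2 \<le> 2 * x^2\<close> this gives the 8 in
    \<open>C\<close>. The other entry of \<open>C\<close> covers
    \<open>\<bar>x\<bar> \<le> R\<close>.\<close>
  define R where "R = 1 + 2 * (\<bar>a\<bar> + \<bar>b\<bar>)"
  define C where "C = max ((1 + (b - a)\<^sup>2) * (1 + R\<^sup>2)) (8 * (b - a))"
  have R: "1 \<le> R" by (simp add: R_def)
  have C: "0 \<le> C" using assms by (simp add: C_def le_max_iff_disj)
  have "\<bar>poisson_riemann_sum a b n x\<bar> * (1 + x\<^sup>2) \<le> C" for n x
  proof (cases "\<bar>x\<bar> \<le> R")
    case True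
    have i: "inverse (real (Suc n)) \<le> 1" by (simp add: inverse_le_1_iff)
    have "\<bar>arctan u - arctan v\<bar> \<le> pi" for u v
      using arctan_bounded[of u] arctan_bounded[of v] by (simp add: abs_le_iff)
    then have "\<bar>(arctan ((b - x) * real (Suc n)) - arctan ((a - x) * real (Suc n))) / pi\<bar> \<le> 1"
      by (simp add: abs_divide)
    moreover have "(b - a)\<^sup>2 * inverse (real (Suc n)) \<le> (b - a)\<^sup>2"
      using i by (intro mult_left_le) auto
    ultimately have "\<bar>poisson_riemann_sum a b n x\<bar> \<le> 1 + (b - a)\<^sup>2"
      using poisson_riemann_sum_error[OF assms, of x n] by linarith
    moreover have "x\<^sup>2 \<le> R\<^sup>2" using True R abs_le_square_iff[of x R] by simp
    ultimately have "\<bar>poisson_riemann_sum a b n x\<bar> * (1 + x\<^sup>2) \<le> (1 + (b -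
        a)\<^sup>2) * (1 + R\<^sup>2)"
      by (intro mult_mono) auto
    then show ?thesis by (simp add: C_def)
  next
    case False
    then have x: "R < \<bar>x\<bar>" by simp
    have x2: "1 \<le> x\<^sup>2" using x R abs_le_square_iff[of 1 x] by simp
    define M where "M = Suc n ^ 3"
    define y where "y = inverse (real (Suc n))"
    define h where "h = (b - a) / real M"
    have M: "0 < M" by (simp add: M_def)
    have y: "0 < y" "y \<le> 1" by (auto simp: y_def inverse_le_1_iff)
    have h: "0 < h" "real M * h = b - a" using assms M by (simp_all add: h_def)
    have pk: "poisson_kernel y x t \<le> 4 / x\<^sup>2" if t: "a \<le> t" "t \<le> b" for t
    proof -
      have "\<bar>t\<bar> \<le> \<bar>a\<bar> + \<bar>b\<bar>"
        using t by (intro abs_leI) linarith+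
      moreover have "p / 2 \<le> q" if "s \<le> w" "1 + 2 * w < p" "p - s \<le> q" "0 \<le> s" for p q s
          w :: real
        using that by linarith
      ultimately have "\<bar>x\<bar> / 2 \<le> \<bar>t - x\<bar>"
        using x abs_triangle_ineq2[of x t] abs_ge_zero[of t] unfolding R_def abs_minus_commute[of t x] by blast
      then have "(\<bar>x\<bar> / 2)\<^sup>2 \<le> (t - x)\<^sup>2" using abs_le_square_iff[of
          "\<bar>x\<bar> / 2" "t - x"] by simp
      then have D: "x\<^sup>2 / 4 \<le> (t - x)\<^sup>2 + y\<^sup>2" by (simp add: power_divide add_increasing2)
      have "poisson_kernel y x t \<le> 1 / (1 * (x\<^sup>2 / 4))"
        unfolding poisson_kernel_def using D y x2 pi_gt3 by (intro frac_le mult_mono) auto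
      then show ?thesis by simp
    qed
    have "poisson_riemann_sum a b n x = (\<Sum>j<M. h * poisson_kernel y x (a + real j * h))"
      by (simp add: poisson_riemann_sum_def M_def h_def y_def)
    moreover have "0 \<le> (\<Sum>j<M. h * poisson_kernel y x (a + real j * h))"
      using h y by (intro sum_nonneg mult_nonneg_nonneg poisson_kernel_nonneg) auto
    moreover have "(\<Sum>j<M. h * poisson_kernel y x (a + real j * h)) \<le> (\<Sum>j<M. h * (4 / x\<^sup>2))"
    proof (intro sum_mono mult_left_mono pk)
      fix j assume "j \<in> {..<M}"
      then have "real j * h \<le> real M * h" using h by (intro mult_right_mono) auto
      then show "a + real j * h \<le> b" using h by simp
    qed (use h in auto)
    moreover have "(\<Sum>j<M. h * (4 / x\<^sup>2)) = (b - a) * (4 / x\<^sup>2)"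
      using h(2) by (simp flip: mult.assoc)
    ultimately have "\<bar>poisson_riemann_sum a b n x\<bar> * (1 + x\<^sup>2) \<le> ((b - a) * (4 /
        x\<^sup>2)) * (2 * x\<^sup>2)"
      using x2 by (intro mult_mono) auto
    also have "\<dots> = 8 * (b - a)" using x2 by auto
    finally show ?thesis by (simp add: C_def)
  qed
  \<comment> \<open>The decay obtained is of second order; it is weakened to the shape of
    \<open>decay_weight\<close>.\<close>
  moreover have "inverse (1 + x\<^sup>2) \<le> sqrt (inverse (1 + x\<^sup>2))" for x :: real
  proof (rule real_le_rsqrt)
    have "0 \<le> inverse (1 + x\<^sup>2)" "inverse (1 + x\<^sup>2) \<le> 1" by (simp_all add: inverse_le_1_iff)
    then show "(inverse (1 + x\<^sup>2))\<^sup>2 \<le> inverse (1 + x\<^sup>2)"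
      unfolding power2_eq_square[of "inverse (1 + x\<^sup>2)"] by (intro mult_left_le)
  qed
  ultimately have "\<bar>poisson_riemann_sum a b n x\<bar> \<le> C * sqrt (inverse (1 + x\<^sup>2))" for n x
  proof -
    have "0 < 1 + x\<^sup>2" by (simp add: add_pos_nonneg)
    then have "\<bar>poisson_riemann_sum a b n x\<bar> \<le> C * inverse (1 + x\<^sup>2)"
      using \<open>\<bar>poisson_riemann_sum a b n x\<bar> * (1 + x\<^sup>2) \<le> C\<close> by (simp
          add: field_simps)
    also have "\<dots> \<le> C * sqrt (inverse (1 + x\<^sup>2))"
      using C \<open>inverse (1 + x\<^sup>2) \<le> sqrt (inverse (1 + x\<^sup>2))\<close> by (intro
          mult_left_mono)
    finally show ?thesis .
  qed
  then show thesis using C that by blast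
qed

section \<open>From simple poles to all square integrable functions\<close>

locale closed_L2_subspace_poles = closed_L2_subspace +
  assumes pole: "Im a \<noteq> 0 \<Longrightarrow> (\<lambda>x. 1 / (of_real x - a)) \<in> V"
begin

lemma poisson_riemann_sum: "(\<lambda>x. of_real (poisson_riemann_sum a b n x)) \<in> V"
proof -
  have "(\<lambda>x. complex_of_real (poisson_kernel y x t)) \<in> V" if "0 < y" for y t
    unfolding poisson_kernel_partial_fractions[OF that] using that
    by (intro scale diff pole) auto
  then show ?thesis
    unfolding poisson_riemann_sum_def of_real_sum of_real_mult[of "(b - a) / real (Suc n ^ 3)"]
    by (intro sum scale) simp
qed

lemma indicator_interval: "(\<lambda>x. indicator {a..b} x) \<in> V"
proof (cases "a < b")
  case True
  obtain C where C: "0 \<le> C" "\<And>n x. \<bar>poisson_riemann_sum a b n x\<bar> \<le> C * sqrt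
      (inverse (1 + x\<^sup>2))"
    using poisson_riemann_sum_bound[OF True] by blast
  show ?thesis
  proof (rule dominated_limit[OF poisson_riemann_sum decay_weight_L2[of C]])
    show "norm (complex_of_real (poisson_riemann_sum a b n x)) \<le> norm (decay_weight C x)" for n x
      unfolding norm_decay_weight[OF C(1)] norm_of_real by (rule C(2))
    have "AE x in lborel. x \<notin> {a, b}" by (intro AE_not_in countable_imp_null_set_lborel) auto
    then have "AE x in lebesgue. x \<notin> {a, b}" by (rule AE_completion)
    then show "AE x in lebesgue. (\<lambda>n. complex_of_real (poisson_riemann_sum a b n x))
        \<longlonglongrightarrow> indicator {a..b} x"
    proof eventually_elim
      case (elim x)
      have "(\<lambda>n. complex_of_real (poisson_riemann_sum a b n x)) \<longlonglongrightarrow> of_real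
          (indicator {a..b} x)"
        using elim True by (intro tendsto_of_real poisson_riemann_sum_tendsto) auto
      moreover have "complex_of_real (indicator {a..b} x) = indicator {a..b} x" by (simp add: indicator_def)
      ultimately show ?case by (simp only:)
    qed
  qed (auto intro: borel_measurable_indicator)
next
  case False
  \<comment> \<open>Here the interval is empty or a single point, so its indicator is 0 a.e.\<close>
  have "AE x in lborel. x \<notin> {a, b}" by (intro AE_not_in countable_imp_null_set_lborel) auto
  then have "AE x in lebesgue. x \<notin> {a, b}" by (rule AE_completion)
  then have ae: "AE x in lebesgue. (\<lambda>n. 0) \<longlonglongrightarrow> (indicator {a..b} x :: complex)"
    by eventually_elim (use False in \<open>auto simp: indicator_def\<close>)
  show ?thesis
    by (rule dominated_limit[OF zero subset_L2[OF zero] _ ae]) (auto intro: borel_measurable_indicator)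
qed

text \<open>Dynkin's argument over half-lines, which are stable under intersection. The window
  \<open>{-c..c}\<close> keeps complements of finite measure and dominates all partial
  unions.\<close>

lemma indicator_borel:
  assumes "E \<in> sets borel" shows "(\<lambda>x. indicator (E \<inter> {-c..c}) x) \<in> V"
proof -
  have "Int_stable (range (\<lambda>a::real. {..a}))" "range (\<lambda>a::real. {..a}) \<subseteq> Pow UNIV"
    by (auto simp: Int_stable_def)
  moreover have "E \<in> sigma_sets UNIV (range (\<lambda>a. {..a}))"
    using assms by (simp add: borel_eq_atMost sets_measure_of)
  ultimately show ?thesis
  proof (induction rule: sigma_sets_induct_disjoint)
    case (basic A)
    then obtain a where "A = {..a}" by auto
    then have "A \<inter> {-c..c} = {-c..min a c}" by auto
    then show ?case using indicator_interval by simp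
  next
    case (compl A)
    have "(indicator ((UNIV - A) \<inter> {-c..c}) x :: complex) = indicator {-c..c} x - indicator (A
        \<inter> {-c..c}) x" for x
      by (auto simp: indicator_def)
    then show ?case using diff[OF indicator_interval compl(2)] by simp
  next
    case (union A)
    have meas: "A i \<in> sets borel" for i
      using union(2) by (auto simp: borel_eq_atMost sets_measure_of)
    let ?s = "\<lambda>n x. \<Sum>i<n. indicator (A i \<inter> {-c..c}) x :: complex"
    have s: "?s n x = indicator ((\<Union>i<n. A i) \<inter> {-c..c}) x" for n x
    proof -
      have disj: "disjoint_family_on (\<lambda>i. A i \<inter> {-c..c}) {..<n}"
        using union(1) unfolding disjoint_family_on_def by blast
      have "(\<Union>i<n. A i) \<inter> {-c..c} = (\<Union>i<n. A i \<inter> {-c..c})" by auto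
      then show ?thesis
        by (simp only: indicator_UN_disjoint[OF finite_lessThan disj])
    qed
    show ?case
    proof (rule dominated_limit[of ?s, OF sum subset_L2[OF indicator_interval[of "-c" c]]])
      show "AE x in lebesgue. (\<lambda>n. ?s n x) \<longlonglongrightarrow> indicator ((\<Union>i. A i)
          \<inter> {-c..c}) x"
      proof (rule AE_I2)
        fix x
        have "\<forall>\<^sub>F n in sequentially. ?s n x = indicator ((\<Union>i. A i) \<inter> {-c..c}) x"
        proof (cases "x \<in> (\<Union>i. A i)")
          case True
          then obtain k where k: "x \<in> A k" by auto
          show ?thesis
          proof (rule eventually_sequentiallyI[of "Suc k"])
            fix n assume "Suc k \<le> n"
            then have "x \<in> (\<Union>i<n. A i)" using k by (intro UN_I[of k]) auto
            then show "?s n x = indicator ((\<Union>i. A i) \<inter> {-c..c}) x"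
              unfolding s using True by (simp only: indicator_def Int_iff)
          qed
        qed (simp add: s indicator_def)
        then show "(\<lambda>n. ?s n x) \<longlonglongrightarrow> indicator ((\<Union>i. A i) \<inter>
            {-c..c}) x"
          by (rule tendsto_eventually)
      qed
      show "norm (?s n x) \<le> norm (indicator {-c..c} x :: complex)" for n x
        unfolding s by (auto simp: indicator_def)
      show "(\<lambda>x. indicator ((\<Union>i. A i) \<inter> {-c..c}) x :: complex) \<in>
          borel_measurable lebesgue"
        using meas by (intro borel_measurable_indicator sets_completionI_sets) auto
    qed (rule union(3))
  qed (auto simp: zero)
qed

text \<open>Off a null set \<open>E\<close> agrees with its Borel part, which the windows
  \<open>{-real n..real n}\<close> exhaust under the majorant \<open>indicator E\<close>.\<close>

lemma indicator_lebesgue: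
  assumes "E \<in> sets lebesgue" "emeasure lebesgue E < \<infinity>"
  shows "(\<lambda>x. indicator E x) \<in> V"
proof -
  obtain S N N' where E: "E = S \<union> N" "N \<subseteq> N'" "N' \<in> null_sets lborel" "S \<in> sets lborel"
    using assms(1) by (rule sets_completionE)
  have ae: "AE x in lebesgue. x \<notin> N'"
    by (rule AE_completion[OF AE_not_in[OF E(3)]])
  show ?thesis
  proof (rule dominated_limit[of "\<lambda>n x. indicator (S \<inter> {-real n..real n}) x", OF _
      indicator_L2[OF assms]])
    show "AE x in lebesgue. (\<lambda>n. indicator (S \<inter> {-real n..real n}) x :: complex)
        \<longlonglongrightarrow> indicator E x"
      using ae
    proof eventually_elim
      case (elim x)
      obtain k where "\<bar>x\<bar> \<le> real k" using real_arch_simple by blast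
      then have "\<forall>\<^sub>F n in sequentially. (indicator (S \<inter> {-real n..real n}) x ::
          complex) = indicator E x"
        using E elim by (intro eventually_sequentiallyI[of k]) (auto simp: indicator_def)
      then show ?case by (rule tendsto_eventually)
    qed
    show "norm (indicator (S \<inter> {-real n..real n}) x :: complex) \<le> norm (indicator E x ::
        complex)" for n x
      using E(1) by (auto simp: indicator_def)
  qed (use E(4) assms(1) in \<open>auto intro: indicator_borel borel_measurable_indicator\<close>)
qed

lemma simple_function:
  assumes "simple_function lebesgue s" "s \<in> L2" shows "s \<in> V"
proof -
  have fin: "finite (range s)" and sets: "s -` {c} \<in> sets lebesgue" for c
    using simple_functionD[OF assms(1)] by auto
  have "(\<lambda>x. c * indicator (s -` {c}) x) \<in> V" for c
  \<comment> \<open>The level set of 0 may have infinite measure but contributes nothing; for other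
    values Chebyshev's inequality makes the level set finite.\<close>
  proof (cases "c = 0")
    case False
    have "(\<integral>\<^sup>+ x. ennreal ((norm c)\<^sup>2) * indicator (s -` {c}) x \<partial>lebesgue)
        \<le> (\<integral>\<^sup>+ x. ennreal ((norm (s x))\<^sup>2) \<partial>lebesgue)"
      by (intro nn_integral_mono) (auto simp: indicator_def)
    then have "ennreal ((norm c)\<^sup>2) * emeasure lebesgue (s -` {c}) \<le> ennreal ((L2_norm s)\<^sup>2)"
      unfolding nn_integral_L2[OF assms(2)] nn_integral_cmult_indicator[OF sets] .
    then have "ennreal ((norm c)\<^sup>2) * emeasure lebesgue (s -` {c}) < \<infinity>"
      by (rule order.strict_trans1) simp
    then have "emeasure lebesgue (s -` {c}) < \<infinity>"
      using False by (auto simp: ennreal_mult_less_top)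
    then show ?thesis using sets by (intro scale indicator_lebesgue)
  qed (simp add: zero)
  then have "(\<lambda>x. \<Sum>c\<in>range s. c * indicator (s -` {c}) x) \<in> V" by (rule sum)
  moreover have "(\<Sum>c\<in>range s. c * indicator (s -` {c}) x) = s x" for x
  proof -
    have "(\<Sum>c\<in>range s. c * indicator (s -` {c}) x) = (\<Sum>c\<in>range s. if c = s x then c else 0)"
      by (intro sum.cong) (auto simp: indicator_def)
    then show ?thesis using fin by simp
  qed
  ultimately show ?thesis by simp
qed

text \<open>Density of the simple poles in the form in which it is applied: \<open>V\<close> will be
  the set of functions with a given approximation property, not a closed span.\<close>

theorem L2_subset:
  assumes f: "f \<in> L2" shows "f \<in> V"
proof -
  obtain s where s: "\<And>n. simple_function lebesgue (s n)" "\<And>x. (\<lambda>n. s n x)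
      \<longlonglongrightarrow> f x"
    "\<And>n x. norm (s n x) \<le> 2 * norm (f x)"
    using borel_measurable_implies_sequence_metric[OF L2_measurable[OF f], of 0] by auto
  have w: "(\<lambda>x. 2 * f x) \<in> L2" by (rule L2_scale[OF f])
  have le: "norm (s n x) \<le> norm (2 * f x)" for n x using s(3) by (simp add: norm_mult)
  have m: "s n \<in> borel_measurable lebesgue" for n by (rule borel_measurable_simple_function[OF s(1)])
  show ?thesis
    by (rule dominated_limit[OF simple_function[OF s(1) L2_dominated[OF w m le]] w L2_measurable[OF f]
        AE_I2[OF s(2)] le])
qed

end

section \<open>The Hardy projection and its modulations\<close>

lemma norm_L2_inner_le:
  assumes "f \<in> L2" "g \<in> L2" shows "norm (L2_inner f g) \<le> L2_norm f * L2_norm g"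
  unfolding L2_inner_def
  using norm_integral_mult_le_L2_norm[OF assms(1) L2_cnj[OF assms(2)]] by (simp only: L2_norm_cnj)

lemma L2_inner_self: "L2_inner f f = of_real ((L2_norm f)\<^sup>2)"
  unfolding L2_inner_def L2_norm_square by (simp add: complex_norm_square[symmetric] flip:
      integral_complex_of_real)

lemma L2_inner_add_left:
  assumes "f \<in> L2" "g \<in> L2" "h \<in> L2"
  shows "L2_inner (\<lambda>x. f x + g x) h = L2_inner f h + L2_inner g h"
  unfolding L2_inner_def distrib_right
  by (intro Bochner_Integration.integral_add integrable_L2_mult L2_cnj assms)

lemma L2_inner_diff_left:
  assumes "f \<in> L2" "g \<in> L2" "h \<in> L2"
  shows "L2_inner (\<lambda>x. f x - g x) h = L2_inner f h - L2_inner g h"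
  unfolding L2_inner_def left_diff_distrib
  by (intro Bochner_Integration.integral_diff integrable_L2_mult L2_cnj assms)

lemma L2_inner_diff_right:
  assumes "f \<in> L2" "g \<in> L2" "h \<in> L2"
  shows "L2_inner h (\<lambda>x. f x - g x) = L2_inner h f - L2_inner h g"
  unfolding L2_inner_def complex_cnj_diff right_diff_distrib
  by (intro Bochner_Integration.integral_diff integrable_L2_mult L2_cnj assms)

lemma hardy_H2_L2: "h \<in> hardy_H2 \<Longrightarrow> h \<in> L2"
  by (simp add: hardy_H2_def)

lemma hardy_H2_orthogonal_cnj:
  assumes "h \<in> hardy_H2" "G \<in> regular_UHP"
  shows "L2_inner (\<lambda>x. cnj (G (of_real x))) h = 0"
proof -
  have "L2_inner (\<lambda>x. cnj (G (of_real x))) h = (LINT x|lebesgue. cnj (h x * G (of_real x)))"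
    by (simp add: L2_inner_def mult.commute)
  then show ?thesis
    by (simp only: Bochner_Integration.integral_cnj hardy_H2_orthogonal[OF assms] complex_cnj_zero)
qed

text \<open>\<open>N f e\<close> is to be read as "f can be approximated within e", and the
  hypotheses carry the errors that the triangle inequality produces. Scaling by 0 is left to
  \<open>zero\<close>, since its error \<open>norm c * e\<close> would be 0 and the approximations
  below are strict.\<close>

lemma closed_L2_subspaceI:
  assumes zero: "\<And>e. 0 < e \<Longrightarrow> N (\<lambda>x. 0) e"
    and add: "\<And>f g d e. f \<in> L2 \<Longrightarrow> g \<in> L2 \<Longrightarrow> N f d
        \<Longrightarrow> N g e \<Longrightarrow> N (\<lambda>x. f x + g x) (d + e)"
    and scale: "\<And>f c e. f \<in> L2 \<Longrightarrow> c \<noteq> 0 \<Longrightarrow> N f e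
        \<Longrightarrow> N (\<lambda>x. c * f x) (norm c * e)"
    and perturb: "\<And>f g d e. f \<in> L2 \<Longrightarrow> g \<in> L2 \<Longrightarrow> N f d
        \<Longrightarrow> L2_norm (\<lambda>x. f x - g x) \<le> e \<Longrightarrow> N g (d + e)"
  shows "closed_L2_subspace {f \<in> L2. \<forall>e>0. N f e}"
proof
  show "f \<in> L2" if "f \<in> {f \<in> L2. \<forall>e>0. N f e}" for f using that by simp
  show "(\<lambda>x. 0) \<in> {f \<in> L2. \<forall>e>0. N f e}" using zero by (simp add: L2_def)
  show "(\<lambda>x. f x + g x) \<in> {f \<in> L2. \<forall>e>0. N f e}"
    if "f \<in> {f \<in> L2. \<forall>e>0. N f e}" "g \<in> {f \<in> L2. \<forall>e>0. N f e}" for f g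
  proof -
    have "N (\<lambda>x. f x + g x) e" if "0 < e" for e
      using add[of f g "e / 2" "e / 2"] \<open>f \<in> _\<close> \<open>g \<in> _\<close> that by simp
    then show ?thesis using that L2_add by blast
  qed
  show "(\<lambda>x. c * f x) \<in> {f \<in> L2. \<forall>e>0. N f e}" if "f \<in> {f \<in> L2.
      \<forall>e>0. N f e}" for f c
  proof -
    have "N (\<lambda>x. c * f x) e" if "0 < e" for e
    proof (cases "c = 0")
      case False
      then show ?thesis using scale[of f c "e / norm c"] \<open>f \<in> _\<close> that by simp
    qed (use zero that in simp)
    then show ?thesis using that L2_scale by blast
  qed
  show "f \<in> {f \<in> L2. \<forall>e>0. N f e}"
    if s: "\<And>n. s n \<in> {f \<in> L2. \<forall>e>0. N f e}" and f: "f \<in> L2"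
      and lim: "(\<lambda>n. L2_norm (\<lambda>x. s n x - f x)) \<longlonglongrightarrow> 0" for s f
  proof -
    have "N f e" if e: "0 < e" for e
    proof -
      obtain n where "L2_norm (\<lambda>x. s n x - f x) < e / 2"
        using order_tendstoD(2)[OF lim half_gt_zero[OF e]] eventually_sequentially by auto
      then show ?thesis
        using perturb[of "s n" f "e / 2" "e / 2"] s[of n] f e by simp
    qed
    then show ?thesis using f by blast
  qed
qed

text \<open>Pythagoras, since regular traces are orthogonal to conjugates of regular traces. It
  makes the analytic parts of a Cauchy sequence of sums \<open>G + cnj H\<close> a Cauchy sequence
  themselves.\<close>

lemma L2_norm_regular_le:
  assumes G: "G \<in> regular_UHP" and H: "H \<in> regular_UHP"
  shows "L2_norm (\<lambda>x. G (of_real x)) \<le> L2_norm (\<lambda>x. G (of_real x) + cnj (H (of_real x)))"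
proof -
  let ?g = "\<lambda>x. G (of_real x)" and ?h = "\<lambda>x. cnj (H (of_real x))"
  have L2: "?g \<in> L2" "?h \<in> L2"
    using G H by (auto intro: regular_UHP_L2_real L2_cnj)
  have "of_real ((L2_norm ?g)\<^sup>2) = L2_inner (\<lambda>x. ?g x + ?h x) ?g"
    using hardy_H2_orthogonal_cnj[OF regular_UHP_hardy_H2[OF G] H]
    by (simp add: L2_inner_add_left L2 L2_inner_self)
  then have "norm (complex_of_real ((L2_norm ?g)\<^sup>2)) \<le> L2_norm (\<lambda>x. ?g x + ?h x) * L2_norm ?g"
    using norm_L2_inner_le[OF L2_add[OF L2] L2(1)] by simp
  then have "L2_norm ?g * L2_norm ?g \<le> L2_norm (\<lambda>x. ?g x + ?h x) * L2_norm ?g"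
    unfolding norm_of_real abs_power2 by (simp only: power2_eq_square)
  moreover have "L2_norm ?g = 0 \<or> 0 < L2_norm ?g"
    using L2_norm_nonneg[of ?g] by linarith
  ultimately show ?thesis by auto
qed

lemma L2_inverse_pole:
  assumes a: "Im a \<noteq> 0" shows "(\<lambda>x. 1 / (of_real x - a)) \<in> L2"
proof (cases "Im a < 0")
  case False
  then have "Im (cnj a) < 0" using a by simp
  from L2_cnj[OF regular_UHP_L2_real[OF regular_UHP_inverse[OF this]]] show ?thesis by simp
qed (rule regular_UHP_L2_real[OF regular_UHP_inverse])

text \<open>The approximable functions form a closed subspace. It contains every simple pole: one
  below the axis is itself a regular trace, one above it is the conjugate of one.\<close>

lemma L2_approx_regular:
  assumes f: "f \<in> L2" and e: "0 < e"
  obtains G H where "G \<in> regular_UHP" "H \<in> regular_UHP"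
    "L2_norm (\<lambda>x. (G (of_real x) + cnj (H (of_real x))) - f x) < e"
proof -
  define N where "N f e \<longleftrightarrow> (\<exists>G\<in>regular_UHP. \<exists>H\<in>regular_UHP.
    L2_norm (\<lambda>x. (G (of_real x) + cnj (H (of_real x))) - f x) < e)" for f e
  have NI: "N f e" if "G \<in> regular_UHP" "H \<in> regular_UHP"
    "L2_norm (\<lambda>x. (G (of_real x) + cnj (H (of_real x))) - f x) < e" for f e G H
    unfolding N_def using that by blast
  have trace: "(\<lambda>x. G (of_real x) + cnj (H (of_real x))) \<in> L2" if "G \<in> regular_UHP" "H
      \<in> regular_UHP" for G H
    using that by (intro L2_add L2_cnj regular_UHP_L2_real)
  have zero_reg: "(\<lambda>z. 0) \<in> regular_UHP"
    by (rule regular_UHPI[of _ 1 0 0]) auto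
  have "closed_L2_subspace {f \<in> L2. \<forall>e>0. N f e}"
  proof (rule closed_L2_subspaceI)
    show "N (\<lambda>x. 0) e" if "0 < e" for e
      by (rule NI[OF zero_reg zero_reg]) (use that in \<open>simp add: L2_norm_def\<close>)
  next
    fix f g d e assume L2: "f \<in> L2" "g \<in> L2" and N: "N f d" "N g e"
    obtain G H where 1: "G \<in> regular_UHP" "H \<in> regular_UHP"
      "L2_norm (\<lambda>x. (G (of_real x) + cnj (H (of_real x))) - f x) < d" using N(1) unfolding N_def
          by blast
    obtain G' H' where 2: "G' \<in> regular_UHP" "H' \<in> regular_UHP"
      "L2_norm (\<lambda>x. (G' (of_real x) + cnj (H' (of_real x))) - g x) < e" using N(2) unfolding
          N_def by blast
    have "L2_norm (\<lambda>x. ((G (of_real x) + G' (of_real x)) + cnj (H (of_real x) + H' (of_real x)))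
        - (f x + g x)) < d + e"
      using L2_norm_triangle[OF L2_diff[OF trace[OF 1(1,2)] L2(1)] L2_diff[OF trace[OF 2(1,2)] L2(2)]] 1(3) 2(3)
      by (simp add: algebra_simps)
    then show "N (\<lambda>x. f x + g x) (d + e)"
      by (rule NI[OF regular_UHP_add[OF 1(1) 2(1)] regular_UHP_add[OF 1(2) 2(2)]])
  next
    fix f e and c :: complex assume L2: "f \<in> L2" and c: "c \<noteq> 0" and N: "N f e"
    obtain G H where 1: "G \<in> regular_UHP" "H \<in> regular_UHP"
      "L2_norm (\<lambda>x. (G (of_real x) + cnj (H (of_real x))) - f x) < e" using N unfolding N_def by blast
    \<comment> \<open>The coefficient of \<open>H\<close> is \<open>cnj c\<close>, so that
      conjugation turns it back into \<open>c\<close>.\<close>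
    have "L2_norm (\<lambda>x. (c * G (of_real x) + cnj (cnj c * H (of_real x))) - c * f x) < norm c * e"
      using L2_norm_scale[of c "\<lambda>x. (G (of_real x) + cnj (H (of_real x))) - f x"] 1(3) c
      by (simp add: algebra_simps)
    then show "N (\<lambda>x. c * f x) (norm c * e)"
      by (rule NI[OF regular_UHP_scale[OF 1(1)] regular_UHP_scale[OF 1(2)]])
  next
    fix f g d e assume L2: "f \<in> L2" "g \<in> L2" and N: "N f d" and le: "L2_norm (\<lambda>x. f x - g
        x) \<le> e"
    obtain G H where 1: "G \<in> regular_UHP" "H \<in> regular_UHP"
      "L2_norm (\<lambda>x. (G (of_real x) + cnj (H (of_real x))) - f x) < d" using N unfolding N_def by blast
    show "N g (d + e)"
      by (rule NI[OF 1(1,2)]) (use L2_norm_triangle_diff[OF trace[OF 1(1,2)] L2] 1(3) le in linarith)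
  qed
  moreover have "N (\<lambda>x. 1 / (of_real x - a)) e" if a: "Im a \<noteq> 0" and e: "0 < e" for a e
  proof (cases "Im a < 0")
    case True
    show ?thesis
      by (rule NI[OF regular_UHP_inverse[OF True] zero_reg]) (use e in \<open>simp add: L2_norm_def\<close>)
  next
    case False
    then have "Im (cnj a) < 0" using a by simp
    show ?thesis
      by (rule NI[OF zero_reg regular_UHP_inverse[OF \<open>Im (cnj a) < 0\<close>]]) (use e in
          \<open>simp add: L2_norm_def\<close>)
  qed
  ultimately interpret closed_L2_subspace_poles "{f \<in> L2. \<forall>e>0. N f e}"
    by (simp add: closed_L2_subspace_poles_def closed_L2_subspace_poles_axioms_def L2_inverse_pole)
  show thesis
    using L2_subset[OF f] e that unfolding N_def by blast
qed

text \<open>The projection is the limit \<open>p\<close> of the analytic parts \<open>G n\<close> of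
  approximants of \<open>f\<close>. The remainder \<open>f - p\<close> is then the limit of the
  \<open>cnj (H n)\<close>, each orthogonal to \<open>hardy_H2\<close>.\<close>

lemma hardy_H2_projection:
  assumes f: "f \<in> L2"
  obtains p where "p \<in> hardy_H2" "\<And>h. h \<in> hardy_H2 \<Longrightarrow> L2_inner (\<lambda>x. f
      x - p x) h = 0"
proof -
  have "\<exists>G H. G \<in> regular_UHP \<and> H \<in> regular_UHP \<and>
      L2_norm (\<lambda>x. (G (of_real x) + cnj (H (of_real x))) - f x) < inverse (real (Suc n))" for n
    by (rule L2_approx_regular[OF f, of "inverse (real (Suc n))"]) auto
  then obtain G H where G: "\<And>n. G n \<in> regular_UHP" and H: "\<And>n. H n \<in> regular_UHP"
    and GH: "\<And>n. L2_norm (\<lambda>x. (G n (of_real x) + cnj (H n (of_real x))) - f x) < inverse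
        (real (Suc n))"
    by metis
  let ?g = "\<lambda>n x. G n (of_real x)" and ?h = "\<lambda>n x. cnj (H n (of_real x))"
  let ?s = "\<lambda>n x. ?g n x + ?h n x"
  have gL2: "?g n \<in> L2" and hL2: "?h n \<in> L2" and sL2: "?s n \<in> L2" for n
    by (intro L2_add L2_cnj regular_UHP_L2_real G H)+
  have lim_s: "(\<lambda>n. L2_norm (\<lambda>x. ?s n x - f x)) \<longlonglongrightarrow> 0"
    by (rule Lim_null_comparison[OF _ LIMSEQ_inverse_real_of_nat]) (use GH[THEN less_imp_le] in auto)
  have g_le: "L2_norm (\<lambda>x. ?g m x - ?g n x) \<le> L2_norm (\<lambda>x. ?s m x - f x) + L2_norm
      (\<lambda>x. ?s n x - f x)" for m n
  proof -
    have "L2_norm (\<lambda>x. ?g m x - ?g n x) \<le> L2_norm (\<lambda>x. ?s m x - ?s n x)"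
      using L2_norm_regular_le[OF regular_UHP_diff[OF G[of m] G[of n]] regular_UHP_diff[OF H[of m] H[of n]]]
      by (simp add: algebra_simps)
    also have "\<dots> \<le> L2_norm (\<lambda>x. ?s m x - f x) + L2_norm (\<lambda>x. f x - ?s n x)"
      by (intro L2_norm_triangle_diff sL2 f)
    finally show ?thesis by (simp only: L2_norm_minus_commute[of f])
  qed
  have "\<exists>N. \<forall>m\<ge>N. \<forall>n\<ge>N. L2_norm (\<lambda>x. ?g m x - ?g n x) < e" if e:
      "0 < e" for e
  proof -
    obtain N where N: "\<And>n. N \<le> n \<Longrightarrow> L2_norm (\<lambda>x. ?s n x - f x) < e / 2"
      using order_tendstoD(2)[OF lim_s half_gt_zero[OF e]] unfolding eventually_sequentially by blast
    have "L2_norm (\<lambda>x. ?g m x - ?g n x) < e" if "N \<le> m" "N \<le> n" for m n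
      using g_le[of m n] N[OF that(1)] N[OF that(2)] by linarith
    then show ?thesis by blast
  qed
  then obtain p where p: "p \<in> L2" and lim_p: "(\<lambda>n. L2_norm (\<lambda>x. ?g n x - p x))
      \<longlonglongrightarrow> 0"
    using L2_complete[of ?g, OF gL2] by blast
  have "L2_inner (\<lambda>x. f x - p x) h = 0" if h: "h \<in> hardy_H2" for h
  proof -
    note hhL2 = hardy_H2_L2[OF h]
    have "norm (L2_inner (\<lambda>x. f x - p x) h) \<le> (L2_norm (\<lambda>x. ?s n x - f x) + L2_norm
        (\<lambda>x. ?g n x - p x)) * L2_norm h" for n
    proof -
      \<comment> \<open>Subtracting \<open>?h n\<close> leaves the inner product unchanged and makes
        the left entry small.\<close>
      have "L2_inner (\<lambda>x. f x - p x) h = L2_inner (\<lambda>x. (f x - p x) - ?h n x) h"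
        using hardy_H2_orthogonal_cnj[OF h H[of n]]
        by (simp add: L2_inner_diff_left[OF L2_diff[OF f p] hL2 hhL2])
      then have "norm (L2_inner (\<lambda>x. f x - p x) h) \<le> L2_norm (\<lambda>x. (f x - p x) - ?h n
          x) * L2_norm h"
        using norm_L2_inner_le[OF L2_diff[OF L2_diff[OF f p] hL2[of n]] hhL2] by simp
      moreover have "L2_norm (\<lambda>x. (f x - p x) - ?h n x) \<le> L2_norm (\<lambda>x. f x - ?s n x)
          + L2_norm (\<lambda>x. ?g n x - p x)"
        using L2_norm_triangle[OF L2_diff[OF f sL2[of n]] L2_diff[OF gL2[of n] p]] by (simp add: algebra_simps)
      ultimately show ?thesis
        unfolding L2_norm_minus_commute[of f "?s n"] by (meson L2_norm_nonneg mult_right_mono order_trans)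
    qed
    moreover have "(\<lambda>n. (L2_norm (\<lambda>x. ?s n x - f x) + L2_norm (\<lambda>x. ?g n x - p x))
        * L2_norm h) \<longlonglongrightarrow> 0"
      using tendsto_mult_left_zero[OF tendsto_add[OF lim_s lim_p, simplified]] by simp
    ultimately have "norm (L2_inner (\<lambda>x. f x - p x) h) \<le> 0"
      by (intro LIMSEQ_le_const) auto
    then show ?thesis by simp
  qed
  with hardy_H2_regular_limit[OF G p lim_p] show thesis by (rule that)
qed

section \<open>Modulation by rapidly oscillating exponentials\<close>

lemma
  assumes "f \<in> L2" "E \<in> borel_measurable lebesgue" "\<And>x. norm (E x) = 1"
  shows L2_unimodular: "(\<lambda>x. E x * f x) \<in> L2"
    and L2_norm_unimodular: "L2_norm (\<lambda>x. E x * f x) = L2_norm f"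
  using assms by (auto simp: L2_def L2_norm_def norm_mult)

lemma exp_i_measurable [measurable]:
  assumes [measurable]: "\<phi> \<in> borel_measurable lebesgue"
  shows "(\<lambda>x. exp (\<i> * of_real (\<phi> x))) \<in> borel_measurable lebesgue"
  by measurable

text \<open>All sufficiently large \<open>k\<close> are covered, which gives convergence of the
  whole sequence; \<open>G\<close> may vary with \<open>k\<close>. Multiplication by the exponential
  preserves norms, so replacing \<open>f\<close> costs the same error for every \<open>k\<close> and
  the density argument applies.\<close>

lemma modulation_approx_regular:
  assumes f: "f \<in> L2" and e: "0 < e"
  obtains k0 where "\<And>k. k0 \<le> k \<Longrightarrow> \<exists>G\<in>regular_UHP. L2_norm
      (\<lambda>x. G (of_real x) - exp (\<i> * of_real (k * x)) * f x) < e"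
proof -
  let ?e = "\<lambda>k x. exp (\<i> * complex_of_real (k * x))"
  have norm_e: "norm (?e k x) = 1" for k x by (rule norm_exp_i_times)
  have e_meas: "?e k \<in> borel_measurable lebesgue" for k
    by (intro continuous_imp_measurable_lebesgue continuous_intros)
  have mod_L2: "(\<lambda>x. ?e k x * f x) \<in> L2" if "f \<in> L2" for f k
    by (rule L2_unimodular[OF that e_meas norm_e])
  define N where "N f e \<longleftrightarrow> (\<exists>k0. \<forall>k\<ge>k0.
      \<exists>G\<in>regular_UHP. L2_norm (\<lambda>x. G (of_real x) - ?e k x * f x) < e)" for f e
  have NI: "N f e" if "\<And>k. k0 \<le> k \<Longrightarrow> G k \<in> regular_UHP"
    "\<And>k. k0 \<le> k \<Longrightarrow> L2_norm (\<lambda>x. G k (of_real x) - ?e k x * f x) < e" for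
        f e G k0
    unfolding N_def using that by blast
  have ND: "\<exists>k0 G. \<forall>k\<ge>k0. G k \<in> regular_UHP \<and> L2_norm (\<lambda>x. G k
      (of_real x) - ?e k x * f x) < e" if "N f e" for f e
    using that unfolding N_def by metis
  have "closed_L2_subspace {f \<in> L2. \<forall>e>0. N f e}"
  proof (rule closed_L2_subspaceI)
    have "(\<lambda>z. 0) \<in> regular_UHP" by (rule regular_UHPI[of _ 1 0 0]) auto
    then show "N (\<lambda>x. 0) e" if "0 < e" for e
      by (rule NI[of 0]) (use that in \<open>simp add: L2_norm_def\<close>)
  next
    fix f g d e assume L2: "f \<in> L2" "g \<in> L2" and N: "N f d" "N g e"
    obtain k1 F where 1: "\<And>k. k1 \<le> k \<Longrightarrow> F k \<in> regular_UHP"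
      "\<And>k. k1 \<le> k \<Longrightarrow> L2_norm (\<lambda>x. F k (of_real x) - ?e k x * f x) < d"
          using ND[OF N(1)] by blast
    obtain k2 G where 2: "\<And>k. k2 \<le> k \<Longrightarrow> G k \<in> regular_UHP"
      "\<And>k. k2 \<le> k \<Longrightarrow> L2_norm (\<lambda>x. G k (of_real x) - ?e k x * g x) < e"
          using ND[OF N(2)] by blast
    show "N (\<lambda>x. f x + g x) (d + e)"
    proof (rule NI[of "max k1 k2" "\<lambda>k z. F k z + G k z"])
      fix k assume "max k1 k2 \<le> k"
      then have k: "k1 \<le> k" "k2 \<le> k" by auto
      show "(\<lambda>z. F k z + G k z) \<in> regular_UHP" by (intro regular_UHP_add 1 2 k)
      show "L2_norm (\<lambda>x. F k (of_real x) + G k (of_real x) - ?e k x * (f x + g x)) < d + e"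
        using L2_norm_triangle[OF L2_diff[OF regular_UHP_L2_real[OF 1(1)[OF k(1)]] mod_L2[OF L2(1), of k]]
            L2_diff[OF regular_UHP_L2_real[OF 2(1)[OF k(2)]] mod_L2[OF L2(2), of k]]]
          1(2)[OF k(1)] 2(2)[OF k(2)] by (simp add: algebra_simps)
    qed
  next
    fix f e and c :: complex assume L2: "f \<in> L2" and c: "c \<noteq> 0" and N: "N f e"
    obtain k1 F where 1: "\<And>k. k1 \<le> k \<Longrightarrow> F k \<in> regular_UHP"
      "\<And>k. k1 \<le> k \<Longrightarrow> L2_norm (\<lambda>x. F k (of_real x) - ?e k x * f x) < e"
          using ND[OF N] by blast
    show "N (\<lambda>x. c * f x) (norm c * e)"
    proof (rule NI[of k1 "\<lambda>k z. c * F k z"])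
      fix k assume k: "k1 \<le> k"
      show "(\<lambda>z. c * F k z) \<in> regular_UHP" by (intro regular_UHP_scale 1 k)
      show "L2_norm (\<lambda>x. c * F k (of_real x) - ?e k x * (c * f x)) < norm c * e"
        using L2_norm_scale[of c "\<lambda>x. F k (of_real x) - ?e k x * f x"] 1(2)[OF k] c
        by (simp add: algebra_simps)
    qed
  next
    fix f g d e assume L2: "f \<in> L2" "g \<in> L2" and N: "N f d" and le: "L2_norm (\<lambda>x. f x - g
        x) \<le> e"
    obtain k1 F where 1: "\<And>k. k1 \<le> k \<Longrightarrow> F k \<in> regular_UHP"
      "\<And>k. k1 \<le> k \<Longrightarrow> L2_norm (\<lambda>x. F k (of_real x) - ?e k x * f x) < d"
          using ND[OF N] by blast
    show "N g (d + e)"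
    proof (rule NI[of k1 F])
      fix k assume k: "k1 \<le> k"
      show "F k \<in> regular_UHP" by (rule 1(1)[OF k])
      have "L2_norm (\<lambda>x. ?e k x * f x - ?e k x * g x) = L2_norm (\<lambda>x. f x - g x)"
        using L2_norm_unimodular[OF L2_diff[OF L2] e_meas norm_e, of k] by (simp add: right_diff_distrib)
      then show "L2_norm (\<lambda>x. F k (of_real x) - ?e k x * g x) < d + e"
        using L2_norm_triangle_diff[OF regular_UHP_L2_real[OF 1(1)[OF k]] mod_L2[OF L2(1), of k]
            mod_L2[OF L2(2), of k]]
          1(2)[OF k] le by linarith
    qed
  qed
  moreover have "N (\<lambda>x. 1 / (of_real x - a)) e" if a: "Im a \<noteq> 0" and e: "0 < e" for a e
  proof (cases "Im a < 0")
    case True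
    show ?thesis
    \<comment> \<open>For a pole below the axis the modulated function is itself a regular trace, so
      the error is 0 from \<open>k = 0\<close> on.\<close>
    proof (rule NI[of 0 "\<lambda>k z. exp (\<i> * of_real k * z) / (z - a)"])
      fix k :: real assume k: "0 \<le> k"
      show "(\<lambda>z. exp (\<i> * of_real k * z) / (z - a)) \<in> regular_UHP"
      proof (rule regular_UHPI)
        show "(\<lambda>z. exp (\<i> * of_real k * z) / (z - a)) holomorphic_on {z. - (- Im a) < Im z}"
          by (intro holomorphic_intros) auto
        show "norm (exp (\<i> * of_real k * z) / (z - a)) * norm z \<le> 2" if "2 * norm a + 1 \<le> norm
            z" "0 \<le> Im z" for z
        proof -
          have "norm (exp (\<i> * of_real k * z)) \<le> 1" using that k by (simp add: norm_exp_eq_Re)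
          moreover have "norm z / 2 \<le> norm (z - a)" using norm_triangle_ineq2[of z a] that by simp
          moreover have pos: "0 < norm z" using that norm_ge_zero[of a] by linarith
          ultimately have "norm (exp (\<i> * of_real k * z)) / norm (z - a) \<le> 1 / (norm z / 2)"
            by (intro frac_le) auto
          then show ?thesis using pos by (simp add: norm_divide pos_le_divide_eq)
        qed
      qed (use True in simp)
    qed (use e in \<open>simp add: L2_norm_def mult.assoc\<close>)
  next
    case False
    then have a: "0 < Im a" using a by simp
    define c where "c = L2_norm (\<lambda>x. 1 / (of_real x - a)) + 1"
    have c: "0 < c" by (simp add: c_def add_nonneg_pos)
    have "((\<lambda>k. exp (- (k * Im a)) * c) \<longlongrightarrow> 0 * c) at_top"
      using a by (intro tendsto_mult tendsto_const filterlim_compose[OF exp_at_bot])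
        (simp add: filterlim_uminus_at_bot filterlim_at_top_mult_tendsto_pos[OF tendsto_const] filterlim_ident)
    then have "\<forall>\<^sub>F k in at_top. exp (- (k * Im a)) * c < e"
      using order_tendstoD(2) e by fastforce
    then obtain k1 where k1: "\<And>k. k1 \<le> k \<Longrightarrow> exp (- (k * Im a)) * c < e"
      unfolding eventually_at_top_linorder by blast
    have "\<exists>G. 0 \<le> k \<longrightarrow> G \<in> regular_UHP \<and>
        (\<forall>x. G (of_real x) = (?e k x - exp (\<i> * of_real k * a)) / (of_real x - a))" for k
      using regular_UHP_exp_quotient[OF a, of k] by metis
    then obtain G where G: "\<And>k. 0 \<le> k \<Longrightarrow> G k \<in> regular_UHP"
      "\<And>k x. 0 \<le> k \<Longrightarrow> G k (of_real x) = (?e k x - exp (\<i> * of_real k * a)) /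
          (of_real x - a)"
      by metis
    show ?thesis
    proof (rule NI[of "max 0 k1" G])
      fix k assume "max 0 k1 \<le> k"
      then have k: "0 \<le> k" "k1 \<le> k" by auto
      show "G k \<in> regular_UHP" by (rule G(1)[OF k(1)])
      have "G k (of_real x) - ?e k x * (1 / (of_real x - a)) = - exp (\<i> * of_real k * a) * (1 /
          (of_real x - a))" for x
        unfolding G(2)[OF k(1)] by (simp add: diff_divide_distrib)
      then have "L2_norm (\<lambda>x. G k (of_real x) - ?e k x * (1 / (of_real x - a)))
          = norm (- exp (\<i> * of_real k * a)) * L2_norm (\<lambda>x. 1 / (of_real x - a))"
        by (simp only: L2_norm_scale)
      also have "\<dots> \<le> exp (- (k * Im a)) * c"
        by (intro mult_mono) (auto simp: norm_exp_eq_Re c_def)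
      finally show "L2_norm (\<lambda>x. G k (of_real x) - ?e k x * (1 / (of_real x - a))) < e"
        using k1[OF k(2)] by linarith
    qed
  qed
  ultimately interpret closed_L2_subspace_poles "{f \<in> L2. \<forall>e>0. N f e}"
    by (simp add: closed_L2_subspace_poles_def closed_L2_subspace_poles_axioms_def L2_inverse_pole)
  show thesis
    using L2_subset[OF f] e that unfolding N_def by blast
qed

text \<open>\<open>a\<close> is within \<open>e\<close> of the Hardy space and \<open>b\<close>
  within \<open>e\<close> of its complement, so the projection \<open>v\<close> of the sum nearly
  ignores \<open>b\<close>. Two errors bound \<open>v - G\<close>; returning from \<open>G\<close>
  to \<open>a\<close> costs the third.\<close>

lemma projection_dist_le:
  assumes L2: "a \<in> L2" "b \<in> L2" and v: "v \<in> hardy_H2"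
    and proj: "\<And>h. h \<in> hardy_H2 \<Longrightarrow> L2_inner (\<lambda>x. (a x + b x) - v x) h = 0"
    and G: "G \<in> regular_UHP" "L2_norm (\<lambda>x. G (of_real x) - a x) \<le> e"
    and H: "H \<in> regular_UHP" "L2_norm (\<lambda>x. cnj (H (of_real x)) - b x) \<le> e"
  shows "L2_norm (\<lambda>x. v x - a x) \<le> 3 * e"
proof -
  let ?g = "\<lambda>x. G (of_real x)" and ?h = "\<lambda>x. cnj (H (of_real x))"
  let ?w = "\<lambda>x. v x - ?g x"
  have vL2: "v \<in> L2" by (rule hardy_H2_L2[OF v])
  have gL2: "?g \<in> L2" and hL2: "?h \<in> L2" using G H by (auto intro: regular_UHP_L2_real L2_cnj)
  have gH2: "?g \<in> hardy_H2" by (rule regular_UHP_hardy_H2[OF G(1)])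
  have wL2: "?w \<in> L2" by (intro L2_diff vL2 gL2)
  \<comment> \<open>Closure of \<open>hardy_H2\<close> under differences has not been established,
    so orthogonality to \<open>?w\<close> is reduced to that to \<open>v\<close> and
    \<open>?g\<close>.\<close>
  have ortho: "L2_inner f ?w = 0" if "f \<in> L2" "\<And>h. h \<in> hardy_H2 \<Longrightarrow> L2_inner f
      h = 0" for f
    using that v gH2 by (simp add: L2_inner_diff_right[OF vL2 gL2])
  let ?r = "\<lambda>x. (a x + b x) - v x"
  have rL2: "?r \<in> L2" by (intro L2_diff L2_add L2 vL2)
  have zeros: "L2_inner ?r ?w = 0" "L2_inner ?h ?w = 0"
    by (rule ortho[OF rL2 proj], assumption) (rule ortho[OF hL2 hardy_H2_orthogonal_cnj[OF _ H(1)]])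
  let ?d = "\<lambda>x. (a x - ?g x) + (b x - ?h x)"
  \<comment> \<open>\<open>?r\<close> and \<open>?h\<close> are orthogonal to the Hardy space and
    drop out, so the square of the norm of \<open>?w\<close> is its inner product with the error
    \<open>?d\<close>.\<close>
  have "?w = (\<lambda>x. ?d x - (?r x - ?h x))"
    by (simp add: fun_eq_iff)
  then have "L2_inner ?w ?w = L2_inner (\<lambda>x. ?d x - (?r x - ?h x)) ?w"
    by (rule arg_cong)
  also have "\<dots> = L2_inner ?d ?w - (L2_inner ?r ?w - L2_inner ?h ?w)"
    unfolding L2_inner_diff_left[OF L2_add[OF L2_diff[OF L2(1) gL2] L2_diff[OF L2(2) hL2]] L2_diff[OF rL2
        hL2] wL2]
      L2_inner_diff_left[OF rL2 hL2 wL2] ..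
  finally have "L2_inner ?w ?w = L2_inner ?d ?w" by (simp only: zeros diff_0_right)
  then have "norm (L2_inner ?w ?w) \<le> L2_norm (\<lambda>x. (a x - ?g x) + (b x - ?h x)) * L2_norm ?w"
    using norm_L2_inner_le[OF L2_add[OF L2_diff[OF L2(1) gL2] L2_diff[OF L2(2) hL2]] wL2] by simp
  also have "\<dots> \<le> (e + e) * L2_norm ?w"
    using L2_norm_triangle[OF L2_diff[OF L2(1) gL2] L2_diff[OF L2(2) hL2]] G(2) H(2)
    unfolding L2_norm_minus_commute[of ?g a] L2_norm_minus_commute[of ?h b]
    by (intro mult_right_mono) auto
  finally have "L2_norm ?w * L2_norm ?w \<le> (e + e) * L2_norm ?w"
    unfolding L2_inner_self norm_of_real abs_power2 by (simp only: power2_eq_square)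
  moreover have "L2_norm ?w = 0 \<or> 0 < L2_norm ?w"
    using L2_norm_nonneg[of ?w] by linarith
  moreover have "0 \<le> e" using order_trans[OF L2_norm_nonneg G(2)] .
  ultimately have "L2_norm ?w \<le> e + e" by auto
  then show ?thesis
    using L2_norm_triangle_diff[OF vL2 gL2 L2(1)] G(2) by linarith
qed

theorem theorem3p7:
  fixes B :: "real set"
  assumes "B \<in> sets lebesgue"
  shows "\<exists>(k :: nat \<Rightarrow> real) (\<psi> :: nat \<Rightarrow> real \<Rightarrow> real)
            (P :: nat \<Rightarrow> (real \<Rightarrow> complex) \<Rightarrow> real \<Rightarrow> complex).
           (\<forall>n. k n > 0 \<and> \<psi> n \<in> borel_measurable lebesgue \<and>
                is_orth_proj (modulated_H2 (k n) (\<psi> n)) (P n)) \<and>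
           SOT_tendsto P (mult_indicator B)"
proof -
  define \<psi> where "\<psi> x = (if x \<in> B then - x else x)" for x :: real
  have \<psi>_meas: "\<psi> \<in> borel_measurable lebesgue"
  proof -
    have "(\<lambda>x. x) \<in> borel_measurable (lebesgue :: real measure)"
      by (intro continuous_imp_measurable_lebesgue continuous_intros)
    then show ?thesis
      unfolding \<psi>_def using assms by (intro measurable_If_set borel_measurable_uminus) auto
  qed
  define E where "E r x = exp (\<i> * of_real (r * \<psi> x))" for r x
  have E_norm: "norm (E r x) = 1" for r x unfolding E_def by (rule norm_exp_i_times)
  have E_meas: "E r \<in> borel_measurable lebesgue" for r
    unfolding E_def using \<psi>_meas by (intro exp_i_measurable borel_measurable_times) auto
  have E_inverse: "E r x * E (- r) x = 1" "E (- r) x * E r x = 1" for r x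
    by (simp_all add: E_def flip: exp_add)
  have E_cnj: "cnj (E r x) = E (- r) x" for r x by (simp add: E_def exp_cnj)
  have E_L2: "(\<lambda>x. E r x * f x) \<in> L2" if "f \<in> L2" for f r
    by (rule L2_unimodular[OF that E_meas E_norm])
  have "\<exists>p. f \<in> L2 \<longrightarrow> p \<in> hardy_H2 \<and> (\<forall>h\<in>hardy_H2.
      L2_inner (\<lambda>x. f x - p x) h = 0)" for f
    using hardy_H2_projection[of f] by metis
  then obtain Q where Q: "\<And>f. f \<in> L2 \<Longrightarrow> Q f \<in> hardy_H2"
    "\<And>f h. f \<in> L2 \<Longrightarrow> h \<in> hardy_H2 \<Longrightarrow> L2_inner (\<lambda>x. f x
        - Q f x) h = 0"
    by metis
  define P where "P r f x = E r x * Q (\<lambda>x. E (- r) x * f x) x" for r f x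
  have proj: "is_orth_proj (modulated_H2 r \<psi>) (P r)" for r
    unfolding is_orth_proj_def
  proof (intro ballI conjI)
    fix f assume f: "f \<in> L2"
    let ?u = "\<lambda>x. E (- r) x * f x"
    show "P r f \<in> modulated_H2 r \<psi>"
      unfolding modulated_H2_def P_def E_def using Q(1)[OF E_L2[OF f, of "- r"]] by (auto simp: E_def)
    fix h' assume "h' \<in> modulated_H2 r \<psi>"
    then obtain h where h: "h \<in> hardy_H2" and h': "h' = (\<lambda>x. E r x * h x)"
      by (auto simp: modulated_H2_def E_def)
    \<comment> \<open>The unimodular factor of \<open>h'\<close> moves to the left entry as
      \<open>E (- r)\<close>, where it cancels the one in \<open>P\<close>.\<close>
    have "(f x - P r f x) * cnj (h' x) = (?u x - Q ?u x) * cnj (h x)" for x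
    proof -
      have "(f x - P r f x) * cnj (h' x) = (E (- r) x * f x - (E (- r) x * E r x) * Q ?u x) * cnj (h x)"
        unfolding P_def h' complex_cnj_mult E_cnj by (simp add: algebra_simps)
      then show ?thesis by (simp add: E_inverse)
    qed
    then show "L2_inner (\<lambda>x. f x - P r f x) h' = 0"
      using Q(2)[OF E_L2[OF f, of "- r"] h] by (simp add: L2_inner_def)
  qed
  \<comment> \<open>\<open>Suc n\<close> keeps the frequency positive at
    \<open>n = 0\<close>.\<close>
  have "SOT_tendsto (\<lambda>n. P (real (Suc n))) (mult_indicator B)"
    unfolding SOT_tendsto_def
  proof (intro ballI LIMSEQ_I)
    fix f and e :: real assume f: "f \<in> L2" and e: "0 < e"
    let ?e = "\<lambda>k x. exp (\<i> * complex_of_real (k * x))"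
    define f1 where "f1 x = indicator B x * f x" for x
    define f0 where "f0 x = indicator (- B) x * f x" for x
    have f_meas: "f \<in> borel_measurable lebesgue" by (rule L2_measurable[OF f])
    have f1: "f1 \<in> L2" and f0: "f0 \<in> L2"
      unfolding f1_def f0_def using assms
      by (intro L2_dominated[OF f] borel_measurable_times f_meas borel_measurable_indicator;
          auto simp: indicator_def Compl_in_sets_lebesgue)+
    have e_meas: "?e k \<in> borel_measurable lebesgue" for k
      by (intro continuous_imp_measurable_lebesgue continuous_intros)
    have norm_e: "norm (?e k x) = 1" for k x by (rule norm_exp_i_times)
    \<comment> \<open>\<open>projection_dist_le\<close> triples the error, and three quarters of
      \<open>e\<close> still lie strictly below \<open>e\<close>.\<close>
    have e4: "0 < e / 4" using e by simp
    obtain k1 where k1: "\<And>k. k1 \<le> k \<Longrightarrow> \<exists>G\<in>regular_UHP. L2_norm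
        (\<lambda>x. G (of_real x) - ?e k x * f1 x) < e / 4"
      using modulation_approx_regular[OF f1 e4] by blast
    \<comment> \<open>Applied to \<open>cnj f0\<close>: conjugating the result approximates the part
      of frequency \<open>- k\<close> by some \<open>cnj H\<close>, orthogonal to the Hardy
      space.\<close>
    obtain k2 where k2: "\<And>k. k2 \<le> k \<Longrightarrow> \<exists>G\<in>regular_UHP. L2_norm
        (\<lambda>x. G (of_real x) - ?e k x * cnj (f0 x)) < e / 4"
      using modulation_approx_regular[OF L2_cnj[OF f0] e4] by blast
    obtain n0 where n0: "max k1 k2 \<le> real n0" using real_arch_simple by blast
    have "L2_norm (\<lambda>x. P (real (Suc n)) f x - mult_indicator B f x) < e" if n: "n0 \<le> n" for n
    proof -
      define k where "k = real (Suc n)"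
      have k: "k1 \<le> k" "k2 \<le> k" using n0 n by (auto simp: k_def)
      obtain G where G: "G \<in> regular_UHP" "L2_norm (\<lambda>x. G (of_real x) - ?e k x * f1 x) < e / 4"
        using k1[OF k(1)] by blast
      obtain H where H: "H \<in> regular_UHP" "L2_norm (\<lambda>x. H (of_real x) - ?e k x * cnj (f0 x))
          < e / 4"
        using k2[OF k(2)] by blast
      let ?a = "\<lambda>x. ?e k x * f1 x" and ?b = "\<lambda>x. cnj (?e k x * cnj (f0 x))"
      have aL2: "?a \<in> L2" by (rule L2_unimodular[OF f1 e_meas norm_e])
      have bL2: "?b \<in> L2" by (intro L2_cnj L2_unimodular[OF _ e_meas norm_e] f0)
      have H': "L2_norm (\<lambda>x. cnj (H (of_real x)) - ?b x) < e / 4"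
        using H(2) unfolding complex_cnj_diff[symmetric] L2_norm_cnj .
      let ?u = "\<lambda>x. E (- k) x * f x"
      \<comment> \<open>The opposite signs of \<open>\<psi>\<close> on \<open>B\<close> and off
        \<open>B\<close> split the demodulated function into a part \<open>?a\<close> pushed towards
        the Hardy space and a part \<open>?b\<close> pushed towards its complement.\<close>
      have u: "?u = (\<lambda>x. ?a x + ?b x)"
        by (auto simp: fun_eq_iff E_def \<psi>_def f1_def f0_def indicator_def exp_cnj)
      let ?v = "Q ?u"
      have "L2_norm (\<lambda>x. ?v x - ?a x) \<le> 3 * (e / 4)"
      proof (rule projection_dist_le[OF aL2 bL2 Q(1)[OF E_L2[OF f]] _ G(1) less_imp_le[OF G(2)] H(1)
          less_imp_le[OF H']])
        show "L2_inner (\<lambda>x. ?a x + ?b x - ?v x) h = 0" if "h \<in> hardy_H2" for h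
          using Q(2)[OF E_L2[OF f, of "- k"] that] by (simp only: fun_cong[OF u, symmetric])
      qed
      moreover have "P k f x - mult_indicator B f x = E k x * (?v x - ?a x)" for x
      proof -
        \<comment> \<open>On \<open>B\<close>, where \<open>f1\<close> lives, \<open>E k\<close> is
          the inverse of the exponential in \<open>?a\<close>.\<close>
        have "E k x * ?a x = mult_indicator B f x"
          by (auto simp: E_def \<psi>_def f1_def mult_indicator_def indicator_def simp flip: mult.assoc exp_add)
        then show ?thesis by (simp only: P_def right_diff_distrib)
      qed
      then have "L2_norm (\<lambda>x. P k f x - mult_indicator B f x) = L2_norm (\<lambda>x. ?v x - ?a x)"
        using L2_norm_unimodular[OF L2_diff[OF hardy_H2_L2[OF Q(1)[OF E_L2[OF f]]] aL2] E_meas E_norm] by simp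
      ultimately show ?thesis using e by (simp add: k_def)
    qed
    then show "\<exists>no. \<forall>n\<ge>no. norm (L2_norm (\<lambda>x. P (real (Suc n)) f x -
        mult_indicator B f x) - 0) < e"
      by auto
  qed
  then show ?thesis
    using proj \<psi>_meas by (intro exI[of _ "\<lambda>n. real (Suc n)"] exI[of _ "\<lambda>n. \<psi>"]
        exI[of _ "\<lambda>n. P (real (Suc n))"]) auto
qed

end
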